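(* Let $n\geq 32$ be an integer and let $i,m$ be integers with $2\leq i\leq n-2$, $2\leq m\leq n-2$ and $i\neq m$. Then there does not exist a simple graph on $n$ vertices whose Laplacian spectrum is the multiset $$\{0,1,\ldots,m-1,m,m,m+1,\ldots,n-1,n\}\setminus\{i,n\}.$$
   Context: Graphs are finite, simple and unweighted. The Laplacian matrix $L(G)$ of a graph $G$ is indexed by $V(G)$, with $[L(G)]_{v,v}=d_G(v)$ (the degree of $v$), $[L(G)]_{v,w}=-1$ if $\{v,w\}\in E(G)$, and $0$ otherwise. The Laplacian spectrum of $G$ is the multiset of eigenvalues of $L(G)$. In the displayed multiset, the integers $0,1,\ldots,n-1$ other than $i$ and $m$ each appear once, $m$ appears twice, and $i$ and $n$ do not appear. *)

theory Defs
  imports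
    "Graph_Theory.Pair_Digraph"
    "Jordan_Normal_Form.Char_Poly"
    "HOL-Library.Multiset"
begin

text \<open>
  A finite simple graph is a \<^locale>\<open>pair_graph\<close>: a finite set of vertices together with a symmetric
  and irreflexive set of ordered pairs of vertices. An edge \<open>{v, w}\<close> is thus represented by the two
  pairs \<open>(v, w)\<close> and \<open>(w, v)\<close>, and the degree of a vertex is its out-degree.
\<close>

definition laplacian :: "'a pair_pre_digraph \<Rightarrow> 'a \<Rightarrow> 'a \<Rightarrow> real" where
  "laplacian G v w =
     (if v = w then real (out_degree (with_proj G) v)
      else if (v, w) \<in> parcs G then - 1
      else 0)"

text \<open>
  Matrices of the library are indexed by initial segments of the natural numbers, so the
  Laplacian matrix is written down along an enumeration of the vertices. The lemma
  \<open>laplacian_spectrum_eq\<close> below shows that the spectrum does not depend on this choice.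
\<close>

definition laplacian_mat :: "'a pair_pre_digraph \<Rightarrow> 'a list \<Rightarrow> real mat" where
  "laplacian_mat G vs = mat (length vs) (length vs) (\<lambda>(a, b). laplacian G (vs ! a) (vs ! b))"

text \<open>
  The multiset \<^term>\<open>proots p\<close> contains every root of \<open>p\<close> as often as its multiplicity. The Laplacian
  matrix is real symmetric, so all its eigenvalues are real.
\<close>

definition laplacian_spectrum :: "'a pair_pre_digraph \<Rightarrow> real multiset" where
  "laplacian_spectrum G =
     proots (char_poly (laplacian_mat G (SOME vs. distinct vs \<and> set vs = pverts G)))"

lemma char_poly_laplacian_mat_cong:
  assumes "distinct vs" "distinct ws" "set vs = set ws"
  shows "char_poly (laplacian_mat G vs) = char_poly (laplacian_mat G ws)"
proof -
  define n where "n = length vs"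
  have lw: "length ws = n"
    using assms by (metis distinct_card n_def)
  have "\<forall>a<n. \<exists>b<n. ws ! b = vs ! a"
    using assms lw by (metis in_set_conv_nth n_def nth_mem)
  then obtain f where f: "\<And>a. a < n \<Longrightarrow> f a < n \<and> ws ! f a = vs ! a"
    by metis
  have "\<forall>b<n. \<exists>a<n. vs ! a = ws ! b"
    using assms lw by (metis in_set_conv_nth n_def nth_mem)
  then obtain g where g: "\<And>b. b < n \<Longrightarrow> g b < n \<and> vs ! g b = ws ! b"
    by metis
  have fg: "f (g b) = b" if "b < n" for b
    using that f[of "g b"] g[of b] assms(2) lw by (metis nth_eq_iff_index_eq)
  have gf: "g (f a) = a" if "a < n" for a
    using that g[of "f a"] f[of a] assms(1) n_def by (metis nth_eq_iff_index_eq)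
  define P :: "real mat" where "P = mat n n (\<lambda>(a, b). if b = f a then 1 else 0)"
  define Q :: "real mat" where "Q = mat n n (\<lambda>(a, b). if b = g a then 1 else 0)"
  define A where "A = laplacian_mat G vs"
  define B where "B = laplacian_mat G ws"
  have c: "A \<in> carrier_mat n n" "B \<in> carrier_mat n n" "P \<in> carrier_mat n n" "Q \<in> carrier_mat n n"
    by (simp_all add: A_def B_def P_def Q_def laplacian_mat_def n_def lw[unfolded n_def])
  have left: "(P * M) $$ (a, b) = M $$ (f a, b)"
    if "M \<in> carrier_mat n n" "a < n" "b < n" for M a b
  proof -
    have "(P * M) $$ (a, b) = (\<Sum>k = 0..<n. (if k = f a then 1 else 0) * M $$ (k, b))"
      using that c(3) by (simp add: scalar_prod_def P_def)
    also have "\<dots> = (\<Sum>k = 0..<n. if k = f a then M $$ (k, b) else 0)"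
      by (rule sum.cong) auto
    also have "\<dots> = M $$ (f a, b)"
      using f[OF that(2)] by simp
    finally show ?thesis .
  qed
  have right: "(M * Q) $$ (a, b) = M $$ (a, f b)"
    if "M \<in> carrier_mat n n" "a < n" "b < n" for M a b
  proof -
    have "(M * Q) $$ (a, b) = (\<Sum>k = 0..<n. M $$ (a, k) * (if b = g k then 1 else 0))"
      using that c(4) by (simp add: scalar_prod_def Q_def)
    also have "\<dots> = (\<Sum>k = 0..<n. if k = f b then M $$ (a, k) else 0)"
      using gf[OF that(3)] fg by (intro sum.cong) auto
    also have "\<dots> = M $$ (a, f b)"
      using f[OF that(3)] by simp
    finally show ?thesis .
  qed
  have PQ: "P * Q = 1\<^sub>m n"
  proof (rule eq_matI)
    fix a b assume "a < dim_row (1\<^sub>m n :: real mat)" "b < dim_col (1\<^sub>m n :: real mat)"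
    then have ab: "a < n" "b < n" by auto
    have "f a = f b \<longleftrightarrow> a = b"
      using gf ab by metis
    with right[OF c(3) ab] ab f[OF ab(2)] show "(P * Q) $$ (a, b) = 1\<^sub>m n $$ (a, b)"
      unfolding right[OF c(3) ab] by (auto simp: P_def)
  qed (use c in auto)
  have QP: "Q * P = 1\<^sub>m n"
    using mat_mult_left_right_inverse[OF c(3) c(4) PQ] .
  have "A = P * B * Q"
  proof (rule eq_matI)
    fix a b assume "a < dim_row (P * B * Q)" "b < dim_col (P * B * Q)"
    then have ab: "a < n" "b < n" using c by auto
    have "(P * B * Q) $$ (a, b) = B $$ (f a, f b)"
      using right[of "P * B" a b] left[OF c(2) ab(1), of "f b"] ab f[OF ab(2)]
        mult_carrier_mat[OF c(3) c(2)] by metis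
    also have "\<dots> = A $$ (a, b)"
      using ab f[OF ab(1)] f[OF ab(2)] lw
      by (simp add: A_def B_def laplacian_mat_def n_def[symmetric])
    finally show "A $$ (a, b) = (P * B * Q) $$ (a, b)" ..
  qed (use c in auto)
  with c PQ QP have "similar_mat A B"
    by (intro similar_matI[of _ _ P Q n]) auto
  then show ?thesis
    unfolding A_def B_def by (rule char_poly_similar)
qed

lemma laplacian_spectrum_eq:
  assumes "distinct vs" "set vs = pverts G"
  shows "laplacian_spectrum G = proots (char_poly (laplacian_mat G vs))"
proof -
  let ?ws = "SOME ws. distinct ws \<and> set ws = pverts G"
  have "distinct ?ws \<and> set ?ws = pverts G"
    by (rule someI[of _ vs]) (use assms in simp)
  then show ?thesis
    unfolding laplacian_spectrum_def
    using char_poly_laplacian_mat_cong[of ?ws vs G] assms by simp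
qed

end

(*
Only the eigenvalues 1 and n - 1 and the gap between them matter: the spectrum says that on functions
of sum zero the Dirichlet form lies between |h|^2 and (n - 1) |h|^2, so that G and its complement both
have algebraic connectivity 1, with eigenfunctions f and g. Hence neither graph has a cut vertex.
Normalise f and g to have l^1 norm 2. The maximum v and minimum w of f and the maximum s and minimum t
of g can be chosen such that v - t - s - w is an induced path of G.
The flow identities of f and g and the sign pattern of the pair (f, g) show that the absolute
values at these four vertices sum to at least 1. Passing to the complement rotates the roles of the four vertices,
so f v may be assumed to be the largest of them. Then f v >= 1/4, and since
deg v * f v <= 1, the vertex v has degree at most 4. The flow of g past v and the adjacency of the
remaining neighbours of v to s and t then bound the four values tightly enough to make their sum less than 1.
*)
theory Submission
  imports Defs "Jordan_Normal_Form.Schur_Decomposition"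
begin

text \<open>On functions of sum zero the Laplacians of the graph and its complement add up to n
  times the identity, which turns the eigenvalue n - 1 of one into the eigenvalue 1 of the other.
  The bounds on i and m keep 1 and n - 1 in the spectrum and 0 simple. With norm 2 the positive and
  the negative part of an eigenfunction have mass 1 each, so every partial sum lies in [-1, 1]; the
  eigenvalue equation then gives deg x * |f x| <= 1. A large value thus means a small degree, hence
  a large degree in the complement, where the other eigenfunction is small at that vertex. The
  obstacle is a small degree at several of the four vertices, where this bound gives little more
  than 1/2. There the absence of cut vertices helps: the flow out of a set of large values cannot
  leave through a single vertex, so the next value is almost as large, and K nearly equal values
  with sum at most 1 press the maximum down towards 1/K. The hypothesis n >= 32 supplies the
  numbers: the two degrees of a vertex, in the graph and in its complement, add up to at least
  31.\<close>

text \<open>Excluding \<open>x\<close> itself makes \<open>\<lambda>x y. \<not> A x y\<close> describe the complementary graph.\<close>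

definition nbs :: "'a set \<Rightarrow> ('a \<Rightarrow> 'a \<Rightarrow> bool) \<Rightarrow> 'a \<Rightarrow> 'a set" where
  "nbs V A x = {y \<in> V. y \<noteq> x \<and> A x y}"

lemma nbs_subset: "nbs V A x \<subseteq> V"
  by (auto simp: nbs_def)

lemma nbs_not_self [simp]: "x \<notin> nbs V A x"
  by (auto simp: nbs_def)

lemma finite_nbs [simp]: "finite V \<Longrightarrow> finite (nbs V A x)"
  by (auto simp: nbs_def)

lemma card_nbs_compl:
  assumes "finite V" "x \<in> V"
  shows "card (nbs V A x) + card (nbs V (\<lambda>x y. \<not> A x y) x) + 1 = card V"
proof -
  have "V = insert x (nbs V A x \<union> nbs V (\<lambda>x y. \<not> A x y) x)"
    using assms by (auto simp: nbs_def)
  then have "card V = card (insert x (nbs V A x \<union> nbs V (\<lambda>x y. \<not> A x y) x))" by simp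
  also have "\<dots> = card (nbs V A x \<union> nbs V (\<lambda>x y. \<not> A x y) x) + 1"
    using assms by simp
  also have "card (nbs V A x \<union> nbs V (\<lambda>x y. \<not> A x y) x)
      = card (nbs V A x) + card (nbs V (\<lambda>x y. \<not> A x y) x)"
    using assms by (intro card_Un_disjoint) (auto simp: nbs_def)
  finally show ?thesis by simp
qed

lemma sum_nbs_swap:
  fixes h :: "'a \<Rightarrow> 'a \<Rightarrow> real"
  assumes fin: "finite V" and sym: "\<And>x y. A x y \<longleftrightarrow> A y x"
  shows "(\<Sum>x\<in>V. \<Sum>y\<in>nbs V A x. h x y) = (\<Sum>x\<in>V. \<Sum>y\<in>nbs V A x. h y x)"
proof -
  have E: "(\<Sum>x\<in>V. \<Sum>y\<in>nbs V A x. k x y) = (\<Sum>x\<in>V. \<Sum>y\<in>V. if y \<noteq> x \<and> A x y then k x y else 0)"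
    for k :: "'a \<Rightarrow> 'a \<Rightarrow> real"
    using fin by (intro sum.cong[OF refl, of V]) (simp add: nbs_def sum.inter_filter)
  have "(\<Sum>x\<in>V. \<Sum>y\<in>nbs V A x. h x y) = (\<Sum>y\<in>V. \<Sum>x\<in>V. if y \<noteq> x \<and> A x y then h x y else 0)"
    unfolding E by (rule sum.swap)
  also have "\<dots> = (\<Sum>x\<in>V. \<Sum>y\<in>nbs V A x. h y x)"
    unfolding E using sym by (intro sum.cong) auto
  finally show ?thesis .
qed

lemma sum_nbs_compl:
  fixes h :: "'a \<Rightarrow> real"
  assumes fin: "finite V" and x: "x \<in> V"
  shows "(\<Sum>y\<in>nbs V A x. h y) + (\<Sum>y\<in>nbs V (\<lambda>x y. \<not> A x y) x. h y) = (\<Sum>y\<in>V. h y) - h x"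
proof -
  have "V = insert x (nbs V A x \<union> nbs V (\<lambda>x y. \<not> A x y) x)" using x by (auto simp: nbs_def)
  then have "(\<Sum>y\<in>V. h y) = (\<Sum>y\<in>insert x (nbs V A x \<union> nbs V (\<lambda>x y. \<not> A x y) x). h y)" by simp
  also have "\<dots> = h x + (\<Sum>y\<in>nbs V A x \<union> nbs V (\<lambda>x y. \<not> A x y) x. h y)"
    using fin by simp
  also have "(\<Sum>y\<in>nbs V A x \<union> nbs V (\<lambda>x y. \<not> A x y) x. h y)
      = (\<Sum>y\<in>nbs V A x. h y) + (\<Sum>y\<in>nbs V (\<lambda>x y. \<not> A x y) x. h y)"
    using fin by (intro sum.union_disjoint) (auto simp: nbs_def)
  finally show ?thesis by simp
qed

text \<open>No single vertex \<open>z\<close> separates the remaining vertices.\<close>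

definition two_connected :: "'a set \<Rightarrow> ('a \<Rightarrow> 'a \<Rightarrow> bool) \<Rightarrow> bool" where
  "two_connected V A \<longleftrightarrow> (\<forall>z\<in>V. \<forall>S. S \<noteq> {} \<longrightarrow> S \<subset> V - {z} \<longrightarrow>
     (\<exists>x\<in>S. \<exists>y\<in>V - {z} - S. A x y))"

text \<open>Deleting the only possible neighbour would cut \<open>x\<close> off from the rest;
  \<open>3 \<le> card V\<close> ensures that the rest is not empty.\<close>

lemma two_connected_card_nbs:
  assumes "two_connected V A" "finite V" "x \<in> V" "3 \<le> card V"
  shows "2 \<le> card (nbs V A x)"
proof (rule ccontr)
  assume "\<not> ?thesis"
  then have "card (nbs V A x) \<le> 1" by simp
  have "\<exists>z\<in>V. z \<noteq> x \<and> nbs V A x \<subseteq> {z}"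
  proof (cases "nbs V A x = {}")
    case True
    have "V - {x} \<noteq> {}"
    proof
      assume "V - {x} = {}"
      then have "V \<subseteq> {x}" by blast
      then have "card V \<le> 1" using card_mono[of "{x}" V] by simp
      then show False using assms(4) by simp
    qed
    then show ?thesis using True by blast
  next
    case False
    then obtain z where "z \<in> nbs V A x" by blast
    moreover from this have "nbs V A x \<subseteq> {z}"
      using \<open>card (nbs V A x) \<le> 1\<close> assms(2)
      by (metis card_le_Suc0_iff_eq finite_nbs One_nat_def insertI1 subsetI)
    ultimately show ?thesis by (auto simp: nbs_def)
  qed
  then obtain z where z: "z \<in> V" "z \<noteq> x" "nbs V A x \<subseteq> {z}" by blast
  have "{x} \<noteq> V - {z}"
  proof
    assume "{x} = V - {z}"
    then have "V \<subseteq> {x, z}" by blast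
    then have "card V \<le> 2" using card_mono[of "{x,z}" V] z by simp
    then show False using assms(4) by simp
  qed
  then have "{x} \<subset> V - {z}" using z assms(3) by blast
  then obtain y where "y \<in> V - {z} - {x}" "A x y"
    using assms(1) z(1) unfolding two_connected_def by blast
  then show False using z by (auto simp: nbs_def)
qed

abbreviation ppart :: "real \<Rightarrow> real" where "ppart a \<equiv> max a 0"

text \<open>Zero counts as negative, so that a sign is never 0, its square is always 1, and the
  signs of two functions split \<open>V\<close> into four classes.\<close>

definition sg :: "real \<Rightarrow> real" where "sg a = (if 0 < a then 1 else - 1)"

lemma sg_mult_self [simp]: "sg a * sg a = 1"
  by (simp add: sg_def)

lemma sg_mult_abs: "sg a * \<bar>a\<bar> = a" "sg a * a = \<bar>a\<bar>"
  by (auto simp: sg_def)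

section \<open>Eigenfunctions for the eigenvalue one\<close>

text \<open>\<open>eig\<close> says that \<open>f\<close> is an eigenvector of the Laplacian for the
  eigenvalue 1. The norm 2 is chosen to give the positive and the negative part mass 1 each.\<close>

locale fiedler =
  fixes V :: "'a set" and A :: "'a \<Rightarrow> 'a \<Rightarrow> bool" and f :: "'a \<Rightarrow> real"
  assumes fin: "finite V"
    and sym: "A x y \<longleftrightarrow> A y x"
    and eig: "x \<in> V \<Longrightarrow> (\<Sum>y\<in>nbs V A x. f x - f y) = f x"
    and sum0: "(\<Sum>x\<in>V. f x) = 0"
    and sumabs: "(\<Sum>x\<in>V. \<bar>f x\<bar>) = 2"
begin

abbreviation "nb \<equiv> nbs V A"
abbreviation "nn \<equiv> nbs V (\<lambda>x y. \<not> A x y)"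

lemma fiedler_uminus: "fiedler V A (\<lambda>x. - f x)"
proof
  show "finite V" by (rule fin)
  show "A x y = A y x" for x y by (rule sym)
  show "(\<Sum>y\<in>nb x. - f x - - f y) = - f x" if "x \<in> V" for x
  proof -
    have "(\<Sum>y\<in>nb x. - f x - - f y) = - (\<Sum>y\<in>nb x. f x - f y)"
      by (simp add: sum_negf[symmetric] algebra_simps)
    then show ?thesis using eig[OF that] by simp
  qed
  show "(\<Sum>x\<in>V. - f x) = 0" using sum0 by (simp add: sum_negf)
  show "(\<Sum>x\<in>V. \<bar>- f x\<bar>) = 2" using sumabs by simp
qed

lemma sum_ppart: "(\<Sum>x\<in>V. ppart (f x)) = 1" "(\<Sum>x\<in>V. ppart (- f x)) = 1"
proof -
  have 1: "(\<Sum>x\<in>V. ppart (f x)) + (\<Sum>x\<in>V. ppart (- f x)) = 2"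
    unfolding sumabs[symmetric] sum.distrib[symmetric] by (rule sum.cong) auto
  have 2: "(\<Sum>x\<in>V. ppart (f x)) - (\<Sum>x\<in>V. ppart (- f x)) = 0"
  proof -
    have "(\<Sum>x\<in>V. ppart (f x)) - (\<Sum>x\<in>V. ppart (- f x)) = (\<Sum>x\<in>V. f x)"
      unfolding sum_subtractf[symmetric] by (rule sum.cong) auto
    then show ?thesis using sum0 by simp
  qed
  show "(\<Sum>x\<in>V. ppart (f x)) = 1" "(\<Sum>x\<in>V. ppart (- f x)) = 1"
    using 1 2 by linarith+
qed

lemma sum_ppart_le:
  assumes "S \<subseteq> V"
  shows "(\<Sum>x\<in>S. ppart (f x)) \<le> 1" "(\<Sum>x\<in>S. ppart (- f x)) \<le> 1"
  using sum_mono2[OF fin assms, of "\<lambda>x. ppart (f x)"] sum_mono2[OF fin assms, of "\<lambda>x. ppart (- f x)"]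
    sum_ppart by auto

lemma sum_le_one:
  assumes "S \<subseteq> V"
  shows "(\<Sum>x\<in>S. f x) \<le> 1" "- 1 \<le> (\<Sum>x\<in>S. f x)"
proof -
  have "(\<Sum>x\<in>S. f x) \<le> (\<Sum>x\<in>S. ppart (f x))" by (rule sum_mono) simp
  then show "(\<Sum>x\<in>S. f x) \<le> 1" using sum_ppart_le(1)[OF assms] by linarith
  have "(\<Sum>x\<in>S. - f x) \<le> (\<Sum>x\<in>S. ppart (- f x))" by (rule sum_mono) simp
  then show "- 1 \<le> (\<Sum>x\<in>S. f x)" using sum_ppart_le(2)[OF assms] by (simp add: sum_negf)
qed

lemma sum_split: "(\<Sum>x\<in>S. f x) = (\<Sum>x\<in>S. ppart (f x)) - (\<Sum>x\<in>S. ppart (- f x))"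
  unfolding sum_subtractf[symmetric] by (rule sum.cong) auto

lemma deg_eq: "x \<in> V \<Longrightarrow> card (nb x) * f x = f x + (\<Sum>y\<in>nb x. f y)"
  using eig[of x] by (simp add: sum_subtractf)

lemma sum_nb_nn: "x \<in> V \<Longrightarrow> f x + (\<Sum>y\<in>nb x. f y) = - (\<Sum>y\<in>nn x. f y)"
  using sum_nbs_compl[OF fin, of x f A] sum0 by linarith

lemma deg_eq_nn: "x \<in> V \<Longrightarrow> card (nb x) * f x = - (\<Sum>y\<in>nn x. f y)"
  using deg_eq sum_nb_nn by simp

text \<open>By the eigenvalue equation the degree times \<open>f x\<close> is the sum of
  \<open>f\<close> over the closed neighbourhood of \<open>x\<close>, and partial sums lie between
  -1 and 1.\<close>

lemma deg_bound: "x \<in> V \<Longrightarrow> card (nb x) * \<bar>f x\<bar> \<le> 1"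
proof -
  assume x: "x \<in> V"
  have "card (nb x) * f x = (\<Sum>y\<in>insert x (nb x). f y)"
    using deg_eq[OF x] fin by simp
  moreover have "insert x (nb x) \<subseteq> V" using x by (auto simp: nbs_def)
  ultimately have "card (nb x) * f x \<le> 1" "- 1 \<le> card (nb x) * f x"
    using sum_le_one by auto
  then have "\<bar>card (nb x) * f x\<bar> \<le> 1" by linarith
  then show ?thesis by (simp add: abs_mult)
qed

text \<open>A discrete divergence theorem: sum the eigenvalue equation over \<open>S\<close>; the
  edges inside \<open>S\<close> cancel because \<open>f x - f y\<close> is antisymmetric.\<close>

lemma flow:
  assumes "S \<subseteq> V"
  shows "(\<Sum>x\<in>S. \<Sum>y\<in>nb x - S. f x - f y) = (\<Sum>x\<in>S. f x)"
proof -
  have fS: "finite S" using assms fin finite_subset by blast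
  have "(\<Sum>x\<in>S. f x) = (\<Sum>x\<in>S. \<Sum>y\<in>nb x. f x - f y)"
    using eig assms by (intro sum.cong) auto
  also have "\<dots> = (\<Sum>x\<in>S. (\<Sum>y\<in>nb x - S. f x - f y) + (\<Sum>y\<in>nb x \<inter> S. f x - f y))"
  proof (rule sum.cong)
    fix x assume "x \<in> S"
    have "nb x = (nb x - S) \<union> (nb x \<inter> S)" by blast
    then show "(\<Sum>y\<in>nb x. f x - f y) = (\<Sum>y\<in>nb x - S. f x - f y) + (\<Sum>y\<in>nb x \<inter> S. f x - f y)"
      using fin by (subst sum.union_disjoint[symmetric]) auto
  qed simp
  also have "\<dots> = (\<Sum>x\<in>S. \<Sum>y\<in>nb x - S. f x - f y) + (\<Sum>x\<in>S. \<Sum>y\<in>nb x \<inter> S. f x - f y)"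
    by (rule sum.distrib)
  also have "(\<Sum>x\<in>S. \<Sum>y\<in>nb x \<inter> S. f x - f y) = 0"
  proof -
    let ?h = "\<lambda>x y. if x \<noteq> y \<and> A x y then f x - f y else 0"
    have L: "(\<Sum>x\<in>S. \<Sum>y\<in>nb x \<inter> S. f x - f y) = (\<Sum>x\<in>S. \<Sum>y\<in>S. ?h x y)"
      (is "?L = ?R")
    proof (rule sum.cong)
      fix x assume "x \<in> S"
      have "nb x \<inter> S = {y \<in> S. x \<noteq> y \<and> A x y}" using assms by (auto simp: nbs_def)
      then show "(\<Sum>y\<in>nb x \<inter> S. f x - f y) = (\<Sum>y\<in>S. ?h x y)"
        using fS by (simp add: sum.inter_filter)
    qed simp
    have "?R = - ?R"
    proof -
      have "?R = (\<Sum>y\<in>S. \<Sum>x\<in>S. ?h x y)" by (rule sum.swap)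
      also have "\<dots> = (\<Sum>y\<in>S. \<Sum>x\<in>S. - ?h y x)"
        using sym by (intro sum.cong) auto
      also have "\<dots> = - ?R" by (simp add: sum_negf)
      finally show ?thesis .
    qed
    then have "?R = 0" by linarith
    then show ?thesis using L by simp
  qed
  finally show ?thesis by simp
qed

text \<open>The unit current leaving the positive vertices enters each nonpositive vertex \<open>s\<close> through its
  positive neighbours and leaves each positive vertex \<open>t\<close> through its nonpositive neighbours.\<close>

lemma cut_two:
  assumes s: "s \<in> V" "f s \<le> 0" and t: "t \<in> V" "0 \<le> f t" and "s \<noteq> t"
    and deg: "1 \<le> card (nb t)"
  shows "(\<Sum>x\<in>nb s. ppart (f x)) + (\<Sum>x\<in>nb t. ppart (- f x)) \<le> 1"
proof -
  define P where "P = {x \<in> V. 0 < f x}"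
  have PV: "P \<subseteq> V" and fP: "finite P" using fin by (auto simp: P_def)
  have "(\<Sum>x\<in>P. f x) = (\<Sum>x\<in>V. ppart (f x))"
    unfolding P_def using fin by (simp add: sum.inter_filter) (rule sum.cong, auto)
  then have "1 = (\<Sum>x\<in>P. \<Sum>y\<in>nb x - P. f x - f y)" using flow[OF PV] sum_ppart by simp
  \<comment> \<open>On an edge leaving \<open>P\<close> both \<open>f x\<close> and
    \<open>- f y\<close> are nonnegative. The share of \<open>s\<close> is taken from the first sum
    and that of \<open>t\<close> from the second, so they do not compete.\<close>
  also have "\<dots> = (\<Sum>x\<in>P. \<Sum>y\<in>nb x - P. f x) + (\<Sum>x\<in>P. \<Sum>y\<in>nb x - P. - f y)"
    unfolding sum.distrib[symmetric] by (intro sum.cong) auto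
  finally have one: "1 = (\<Sum>x\<in>P. \<Sum>y\<in>nb x - P. f x) + (\<Sum>x\<in>P. \<Sum>y\<in>nb x - P. - f y)" .
  have in_flow: "(\<Sum>y\<in>Y. \<Sum>x\<in>nb y. ppart (f x)) \<le> (\<Sum>x\<in>P. \<Sum>y\<in>nb x - P. f x)"
    if Y: "Y \<subseteq> V - P" for Y
  proof -
    have fY: "finite Y" using Y fin finite_subset by blast
    have "(\<Sum>y\<in>Y. \<Sum>x\<in>nb y. ppart (f x)) = (\<Sum>y\<in>Y. \<Sum>x\<in>P. if y \<noteq> x \<and> A y x then f x else 0)"
    proof (rule sum.cong)
      fix y assume "y \<in> Y"
      have "(\<Sum>x\<in>nb y. ppart (f x)) = (\<Sum>x\<in>{x\<in>V. y \<noteq> x \<and> A y x}. ppart (f x))"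
        by (rule sum.cong) (auto simp: nbs_def)
      also have "\<dots> = (\<Sum>x\<in>V. if y \<noteq> x \<and> A y x then ppart (f x) else 0)"
        using fin by (simp add: sum.inter_filter)
      also have "\<dots> = (\<Sum>x\<in>P. if y \<noteq> x \<and> A y x then ppart (f x) else 0)"
        using fin PV by (intro sum.mono_neutral_right) (auto simp: P_def)
      also have "\<dots> = (\<Sum>x\<in>P. if y \<noteq> x \<and> A y x then f x else 0)"
        by (rule sum.cong) (auto simp: P_def)
      finally show "(\<Sum>x\<in>nb y. ppart (f x)) = (\<Sum>x\<in>P. if y \<noteq> x \<and> A y x then f x else 0)" .
    qed simp
    also have "\<dots> = (\<Sum>x\<in>P. \<Sum>y\<in>Y. if y \<noteq> x \<and> A y x then f x else 0)" by (rule sum.swap)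
    also have "\<dots> \<le> (\<Sum>x\<in>P. \<Sum>y\<in>nb x - P. f x)"
    proof (rule sum_mono)
      fix x assume x: "x \<in> P"
      have "(\<Sum>y\<in>Y. if y \<noteq> x \<and> A y x then f x else 0) = (\<Sum>y\<in>{y\<in>Y. y \<noteq> x \<and> A y x}. f x)"
        using fY by (simp add: sum.inter_filter del: sum_constant)
      also have "\<dots> \<le> (\<Sum>y\<in>nb x - P. f x)"
        using x Y fin sym by (intro sum_mono2) (auto simp: nbs_def P_def)
      finally show "(\<Sum>y\<in>Y. if y \<noteq> x \<and> A y x then f x else 0) \<le> (\<Sum>y\<in>nb x - P. f x)" .
    qed
    finally show ?thesis .
  qed
  have out_nonneg: "0 \<le> (\<Sum>x\<in>P. \<Sum>y\<in>nb x - P. - f y)"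
    by (intro sum_nonneg) (auto simp: P_def nbs_def)
  show ?thesis
  proof (cases "0 < f t")
    case True
    then have tP: "t \<in> P" using t by (simp add: P_def)
    have "(\<Sum>x\<in>nb t. ppart (- f x)) = (\<Sum>x\<in>nb t - P. - f x)"
    proof -
      have "(\<Sum>x\<in>nb t. ppart (- f x)) = (\<Sum>x\<in>nb t - P. ppart (- f x))"
        using fin by (intro sum.mono_neutral_right) (auto simp: P_def)
      also have "\<dots> = (\<Sum>x\<in>nb t - P. - f x)"
        by (rule sum.cong) (auto simp: P_def nbs_def)
      finally show ?thesis .
    qed
    also have "\<dots> \<le> (\<Sum>x\<in>P. \<Sum>y\<in>nb x - P. - f y)"
      by (rule member_le_sum[OF tP]) (auto intro!: sum_nonneg simp: P_def nbs_def fin fP[unfolded P_def])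
    finally show ?thesis using in_flow[of "{s}"] s one by (auto simp: P_def)
  next
    case False
    \<comment> \<open>Here \<open>t\<close> is not in \<open>P\<close>, but its positive and
      negative neighbours balance, so that it can be treated as a second sink next to
      \<open>s\<close>.\<close>
    then have "f t = 0" using t by simp
    then have "(\<Sum>x\<in>nb t. f x) = 0" using deg_eq[OF t(1)] by simp
    then have "(\<Sum>x\<in>nb t. ppart (- f x)) = (\<Sum>x\<in>nb t. ppart (f x))"
      using sum_split[of "nb t"] by simp
    then show ?thesis
      using in_flow[of "{s, t}"] s t one out_nonneg \<open>f t = 0\<close> \<open>s \<noteq> t\<close> by (auto simp: P_def)
  qed
qed

text \<open>Let \<open>S\<close> consist of the \<open>k\<close> largest values of \<open>f\<close> outside \<open>z\<close>. If all of \<open>S\<close> is adjacent to \<open>z\<close>,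
  then the edges to \<open>z\<close> carry all of the outgoing flow \<open>sum f S\<close> but \<open>k * f z\<close>; as \<open>S\<close> has a further
  outgoing edge, the next value is at most \<open>k * f z\<close> below the smallest value on \<open>S\<close>.\<close>

lemma chain:
  fixes K :: nat and X m0 :: real
  assumes tc: "two_connected V A" and z: "z \<in> V" "0 \<le> f z"
    and m: "m \<in> V" "m \<noteq> z" "\<And>x. x \<in> V \<Longrightarrow> f x \<le> f m"
    and nn: "nn z \<noteq> {}"
    and Q: "(\<Sum>x\<in>nn z. ppart (- f x)) \<le> X"
    and m0: "\<And>x. x \<in> nn z \<Longrightarrow> 0 < f x \<Longrightarrow> (\<Sum>x\<in>nn z. ppart (- f x)) \<le> m0"
    and K: "K * (K - 1) \<le> 2 * card (nb z)" "2 \<le> K"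
  shows "f m \<le> m0 \<or> f m \<le> X / card (nb z) * (real K * (real K - 1) / 2)
    \<or> K * f m - X / card (nb z) * ((real K ^ 3 - real K) / 6) \<le> 1"
proof (rule ccontr)
  assume neg: "\<not> ?thesis"
  define d where "d = real (card (nb z))"
  define Q0 where "Q0 = (\<Sum>x\<in>nn z. ppart (- f x))"
  define p where "p = (\<Sum>x\<in>nn z. ppart (f x))"
  define c where "c = X / d"
  have "2 * 1 \<le> K * (K - 1)" using K(2) by (intro mult_le_mono) auto
  then have "1 \<le> card (nb z)" using K(1) by linarith
  then have d: "1 \<le> d" by (simp add: d_def)
  have Kd: "real K * (real K - 1) / 2 \<le> d"
  proof -
    have "real (K * (K - 1)) \<le> real (2 * card (nb z))" using K(1) of_nat_mono by blast
    then show ?thesis using K(2) by (simp add: d_def of_nat_diff)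
  qed
  \<comment> \<open>A positive value at a nonneighbour of \<open>z\<close> enters \<open>p\<close>
    and so lowers \<open>f z\<close>; this trade-off is the source of the alternative with
    \<open>m0\<close>.\<close>
  have bd: "d * f z = Q0 - p"
    using deg_eq_nn[OF z(1)] sum_split[of "nn z"] by (simp add: d_def Q0_def p_def)
  have p0: "0 \<le> p" unfolding p_def by (rule sum_nonneg) simp
  have bc: "f z \<le> c"
  proof -
    have "d * f z \<le> X" using bd p0 Q by (simp add: Q0_def)
    then show ?thesis using d by (simp add: c_def field_simps)
  qed
  have bK: "f z * (real K * (real K - 1) / 2) \<le> c * (real K * (real K - 1) / 2)"
    using bc K(2) by (intro mult_right_mono) auto
  have tri: "real k * (real k + 1) / 2 \<le> real K * (real K - 1) / 2" if "k < K" for k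
  proof -
    have "real k * (real k + 1) \<le> (real K - 1) * real K"
      using that by (intro mult_mono) auto
    then show ?thesis by (simp add: mult.commute)
  qed
  \<comment> \<open>The drop after the j-th value is at most \<open>j * f z\<close>. Adding up the
    drops gives triangular numbers for the single values and the tetrahedral number
    \<open>(k ^ 3 - k) / 6\<close> for their sum.\<close>
  have "\<exists>S. S \<subseteq> V - {z} \<and> card S = k \<and> S \<inter> nn z = {} \<and>
     (\<forall>x\<in>S. f m - f z * (real k * (real k - 1) / 2) \<le> f x) \<and>
     (\<forall>x\<in>S. \<forall>y\<in>V - {z} - S. f y \<le> f x) \<and>
     k * f m - f z * ((real k ^ 3 - real k) / 6) \<le> (\<Sum>x\<in>S. f x)" if "k \<le> K" for k
    using that
  proof (induction k)
    case 0
    show ?case by (rule exI[of _ "{}"]) auto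
  next
    case (Suc k)
    then obtain S where S: "S \<subseteq> V - {z}" "card S = k" "S \<inter> nn z = {}"
      "\<forall>x\<in>S. f m - f z * (real k * (real k - 1) / 2) \<le> f x"
      "\<forall>x\<in>S. \<forall>y\<in>V - {z} - S. f y \<le> f x"
      "k * f m - f z * ((real k ^ 3 - real k) / 6) \<le> (\<Sum>x\<in>S. f x)"
      by auto
    have fS: "finite S" using S(1) fin finite_subset by blast
    have SV: "S \<subset> V - {z}" using S(1,3) nn by (auto simp: nbs_def)
    define T where "T = V - {z} - S"
    have T: "finite T" "T \<noteq> {}" using SV fin by (auto simp: T_def)
    obtain x where x: "x \<in> T" "\<forall>y\<in>T. f y \<le> f x"
    proof -
      have "Max (f ` T) \<in> f ` T" using T by (intro Max_in) auto
      then obtain x where "x \<in> T" "f x = Max (f ` T)" by (metis imageE)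
      then show ?thesis using that T(1) by simp
    qed
    have fx: "f m - f z * (real k * (real k + 1) / 2) \<le> f x"
    proof (cases "k = 0")
      case True
      then have "S = {}" using S(2) fS by simp
      then have "m \<in> T" using m by (simp add: T_def)
      then show ?thesis using x True by simp
    next
      case False
      then have "S \<noteq> {}" using S(2) by auto
      then have "\<exists>u\<in>S. \<exists>y\<in>V - {z} - S. A u y"
        using tc[unfolded two_connected_def, rule_format, OF z(1) _ SV] by simp
      then obtain u y where u: "u \<in> S" and y: "y \<in> T" and uy: "A u y"
        unfolding T_def by blast
      have zn: "z \<in> nb x - S" if "x \<in> S" for x
        using that S(1,3) z(1) sym by (auto simp: nbs_def)
      have ge: "0 \<le> f x - f y" if "x \<in> S" "y \<in> nb x - S - {z}" for x y
        using that S(5) by (auto simp: nbs_def)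
      have "(\<Sum>x\<in>S. f x) = (\<Sum>x\<in>S. \<Sum>y\<in>nb x - S. f x - f y)"
        using S(1) by (intro flow[symmetric]) blast
      also have "\<dots> = (\<Sum>x\<in>S. (f x - f z) + (\<Sum>y\<in>nb x - S - {z}. f x - f y))"
        using zn fin by (intro sum.cong sum.remove) auto
      also have "\<dots> = (\<Sum>x\<in>S. f x) - k * f z + (\<Sum>x\<in>S. \<Sum>y\<in>nb x - S - {z}. f x - f y)"
        by (simp add: sum.distrib sum_subtractf S(2))
      finally have "k * f z = (\<Sum>x\<in>S. \<Sum>y\<in>nb x - S - {z}. f x - f y)" by simp
      also have "\<dots> \<ge> (\<Sum>y\<in>nb u - S - {z}. f u - f y)"
        by (rule member_le_sum[OF u _ fS]) (intro sum_nonneg ge; simp)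
      moreover have "f u - f y \<le> (\<Sum>y\<in>nb u - S - {z}. f u - f y)"
      proof (rule member_le_sum)
        show "y \<in> nb u - S - {z}" using y uy u by (auto simp: T_def nbs_def)
      qed (use ge[OF u] fin in auto)
      ultimately have "f u - f y \<le> k * f z" by linarith
      moreover have "f y \<le> f x" using x y by blast
      moreover have "f m - f z * (real k * (real k - 1) / 2) \<le> f u" using S(4) u by blast
      moreover have "f z * (real k * (real k + 1) / 2) = f z * (real k * (real k - 1) / 2) + k * f z"
        by (simp add: field_simps)
      ultimately show ?thesis by linarith
    qed
    have fz_tri: "f z * (real k * (real k + 1) / 2) \<le> f z * (real K * (real K - 1) / 2)"
      using tri[of k] Suc.prems z(2) by (intro mult_left_mono) auto
    \<comment> \<open>A next value at a nonneighbour of \<open>z\<close> leads to one of the first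
      two alternatives. If it is nonpositive, the drops have used up \<open>f m\<close>; if it is
      positive, it is at most \<open>p\<close>, and the drops are at most
      \<open>d * f z = Q0 - p\<close>, so that \<open>f m \<le> Q0\<close>.\<close>
    have xn: "x \<notin> nn z"
    proof
      assume xn: "x \<in> nn z"
      show False
      proof (cases "f x \<le> 0")
        case True
        then show ?thesis using fx fz_tri bK neg by (simp add: c_def d_def)
      next
        case False
        then have "Q0 \<le> m0" using m0[OF xn] by (simp add: Q0_def)
        moreover have "f x \<le> p"
        proof -
          have "ppart (f x) \<le> p" unfolding p_def using xn fin by (intro member_le_sum) auto
          then show ?thesis by linarith
        qed
        moreover have "f z * (real K * (real K - 1) / 2) \<le> f z * d"
          using Kd z(2) by (intro mult_left_mono)
        ultimately have "f m \<le> m0" using bd fx fz_tri by (simp add: mult.commute)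
        then show ?thesis using neg by simp
      qed
    qed
    have xS: "x \<notin> S" "x \<in> V" "x \<noteq> z" using x by (auto simp: T_def)
    have mono: "f z * (real k * (real k - 1) / 2) \<le> f z * (real k * (real k + 1) / 2)"
      using z(2) by (intro mult_left_mono) (auto simp: field_simps)
    have k1: "real (Suc k) * (real (Suc k) - 1) / 2 = real k * (real k + 1) / 2" by simp
    have k2: "real (Suc k) * f m - f z * ((real (Suc k) ^ 3 - real (Suc k)) / 6)
      = (k * f m - f z * ((real k ^ 3 - real k) / 6)) + (f m - f z * (real k * (real k + 1) / 2))"
      by (simp add: power3_eq_cube field_simps)
    show ?case
    proof (intro exI[of _ "insert x S"] conjI)
      show "insert x S \<subseteq> V - {z}" using S(1) xS by blast
      show "card (insert x S) = Suc k" using S(2) fS xS by simp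
      show "insert x S \<inter> nn z = {}" using S(3) xn by blast
      show "\<forall>y\<in>insert x S. f m - f z * (real (Suc k) * (real (Suc k) - 1) / 2) \<le> f y"
        unfolding k1 using S(4) fx mono by force
      show "\<forall>u\<in>insert x S. \<forall>y\<in>V - {z} - insert x S. f y \<le> f u"
        using S(5) x by (auto simp: T_def)
      show "real (Suc k) * f m - f z * ((real (Suc k) ^ 3 - real (Suc k)) / 6) \<le> (\<Sum>x\<in>insert x S. f x)"
        unfolding k2 using S(6) fx fS xS by simp
    qed
  qed
  from this[of K] obtain S where S: "S \<subseteq> V - {z}"
    "K * f m - f z * ((real K ^ 3 - real K) / 6) \<le> (\<Sum>x\<in>S. f x)" by auto
  have "real K \<le> real K ^ 3" using K(2) by (intro self_le_power) auto
  then have "f z * ((real K ^ 3 - real K) / 6) \<le> c * ((real K ^ 3 - real K) / 6)"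
    using bc by (intro mult_right_mono) auto
  moreover have "(\<Sum>x\<in>S. f x) \<le> 1" using sum_le_one(1)[of S] S(1) by blast
  ultimately show False using neg S(2) by (simp add: c_def d_def)
qed

text \<open>The deficits \<open>f v - f y\<close> along the edges at a maximum \<open>v\<close> add up to \<open>f v\<close>, and similarly at a minimum
  \<open>w\<close>. A common neighbour exhausts both sums, so it is the only neighbour of \<open>v\<close> that is not a maximum;
  if every pair had one, it would be a cut vertex.\<close>

lemma extreme_pair:
  assumes tc: "two_connected V A"
  shows "\<exists>v\<in>V. \<exists>w\<in>V. (\<forall>x\<in>V. f w \<le> f x \<and> f x \<le> f v) \<and> v \<noteq> w \<and> \<not> A v w \<and> nb v \<inter> nb w = {}"
proof (rule ccontr)
  assume neg: "\<not> ?thesis"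
  have V0: "V \<noteq> {}" using sumabs by auto
  define a where "a = Max (f ` V)"
  define b where "b = Min (f ` V)"
  have ab: "b \<le> f x" "f x \<le> a" if "x \<in> V" for x
    using that fin by (auto simp: a_def b_def)
  define S where "S = {x \<in> V. f x = a}"
  define R where "R = {x \<in> V. f x = b}"
  have "a \<in> f ` V" "b \<in> f ` V" using V0 fin by (auto simp: a_def b_def)
  then have ne: "S \<noteq> {}" "R \<noteq> {}" by (auto simp: S_def R_def)
  have a0: "0 < a"
  proof (rule ccontr)
    assume "\<not> 0 < a"
    then have "(\<Sum>x\<in>V. ppart (f x)) = (\<Sum>x\<in>V. 0)" using ab by (intro sum.cong) force+
    then show False using sum_ppart by simp
  qed
  have b0: "b < 0"
  proof (rule ccontr)
    assume "\<not> b < 0"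
    then have "(\<Sum>x\<in>V. ppart (- f x)) = (\<Sum>x\<in>V. 0)" using ab by (intro sum.cong) force+
    then show False using sum_ppart by simp
  qed
  have key: "v \<noteq> w \<and> \<not> A v w \<and> (\<exists>z. nb v \<subseteq> insert z S \<and> nb w \<subseteq> insert z R \<and> z \<in> nb v \<and> z \<in> nb w)"
    if v: "v \<in> S" and w: "w \<in> R" for v w
  proof -
    have vw: "v \<in> V" "w \<in> V" "f v = a" "f w = b" using v w by (auto simp: S_def R_def)
    have ne: "v \<noteq> w" using vw a0 b0 by auto
    have Ev: "(\<Sum>y\<in>nb v. a - f y) = a" using eig[OF vw(1)] vw(3) by simp
    have Ew: "(\<Sum>y\<in>nb w. f y - b) = - b"
      using eig[OF vw(2)] vw(4) by (simp add: sum_subtractf)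
    have nonneg: "0 \<le> a - f y" "0 \<le> f y - b" if "y \<in> nb x" for x y
      using that ab by (auto simp: nbs_def)
    have nA: "\<not> A v w"
    proof
      assume A: "A v w"
      then have mem: "w \<in> nb v" "v \<in> nb w" using vw ne sym by (auto simp: nbs_def)
      have "a - f w \<le> (\<Sum>y\<in>nb v. a - f y)"
        using nonneg fin by (intro member_le_sum[OF mem(1)]) auto
      moreover have "f v - b \<le> (\<Sum>y\<in>nb w. f y - b)"
        using nonneg fin by (intro member_le_sum[OF mem(2)]) auto
      ultimately show False using Ev Ew vw a0 b0 by linarith
    qed
    then obtain z where z: "z \<in> nb v" "z \<in> nb w" using neg vw ne ab by blast
    \<comment> \<open>What remains of the two sums is \<open>f z\<close> at \<open>v\<close> and
      \<open>- f z\<close> at \<open>w\<close>. Both are nonnegative, hence both vanish.\<close>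
    have "(\<Sum>y\<in>nb v. a - f y) = (a - f z) + (\<Sum>y\<in>nb v - {z}. a - f y)"
      using fin by (intro sum.remove z(1)) auto
    moreover have "(\<Sum>y\<in>nb w. f y - b) = (f z - b) + (\<Sum>y\<in>nb w - {z}. f y - b)"
      using fin by (intro sum.remove z(2)) auto
    moreover have ge: "0 \<le> (\<Sum>y\<in>nb v - {z}. a - f y)" "0 \<le> (\<Sum>y\<in>nb w - {z}. f y - b)"
      using nonneg by (auto intro!: sum_nonneg)
    ultimately have "(\<Sum>y\<in>nb v - {z}. a - f y) = 0" "(\<Sum>y\<in>nb w - {z}. f y - b) = 0"
      using Ev Ew by linarith+
    then have "\<forall>y\<in>nb v - {z}. a - f y = 0" "\<forall>y\<in>nb w - {z}. f y - b = 0"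
      using nonneg sum_nonneg_eq_0_iff[of "nb v - {z}" "\<lambda>y. a - f y"]
        sum_nonneg_eq_0_iff[of "nb w - {z}" "\<lambda>y. f y - b"] fin by (metis DiffD1 finite_Diff finite_nbs)+
    then have "nb v \<subseteq> insert z S" "nb w \<subseteq> insert z R"
      by (auto simp: S_def R_def nbs_def)
    then show ?thesis using ne nA z by blast
  qed
  obtain w where w: "w \<in> R" using ne by blast
  have "\<exists>z. \<forall>v\<in>S. nb v \<subseteq> insert z S \<and> z \<in> nb w"
  proof -
    obtain v where v: "v \<in> S" using ne by blast
    obtain z where z: "z \<in> nb w" "z \<in> nb v" using key[OF v w] by blast
    \<comment> \<open>Outside \<open>R\<close> the vertex \<open>w\<close> has only one neighbour,
      so the \<open>z\<close> found for one maximum is the same for all of them.\<close>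
    have "z \<notin> R" using key[OF v, of z] z(2) by (auto simp: nbs_def)
    moreover have "nb v' \<subseteq> insert z S" if "v' \<in> S" for v'
      using key[OF that w] z(1) \<open>z \<notin> R\<close> by blast
    ultimately show ?thesis using z by blast
  qed
  then obtain z where z: "\<And>v. v \<in> S \<Longrightarrow> nb v \<subseteq> insert z S" "z \<in> nb w" using ne by blast
  have zV: "z \<in> V" "z \<noteq> w" using z(2) by (auto simp: nbs_def)
  have zS: "z \<notin> S" using key[OF _ w, of z] z(2) sym by (auto simp: nbs_def)
  have "w \<notin> S" using w a0 b0 by (auto simp: S_def R_def)
  then have "S \<subset> V - {z}" using zS w zV by (auto simp: S_def R_def)
  then obtain x y where "x \<in> S" "y \<in> V - {z} - S" "A x y"
    using tc[unfolded two_connected_def, rule_format, OF zV(1) ne(1)] by blast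
  then show False using z(1)[of x] by (auto simp: nbs_def)
qed

section \<open>Sign patterns and oscillation\<close>

lemmas sum_nb_swap = sum_nbs_swap[where V = V and A = A, OF fin sym]
lemmas sum_nb_nn_eq = sum_nbs_compl[where V = V and A = A, OF fin]

text \<open>Multiply the eigenvalue equation by the sign of \<open>f x\<close> and sum over
  \<open>V\<close>. Only edges on which the sign changes survive: this is the unit flow from the
  positive to the nonpositive vertices, with each such edge counted in both directions and with
  factor 2.\<close>

lemma sign_flow: "(\<Sum>x\<in>V. \<Sum>y\<in>nb x. (1 - sg (f x) * sg (f y)) * \<bar>f x\<bar>) = 2"
proof -
  have "2 = (\<Sum>x\<in>V. sg (f x) * (\<Sum>y\<in>nb x. f x - f y))"
    unfolding sumabs[symmetric] by (intro sum.cong) (simp_all add: eig sg_mult_abs)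
  also have "\<dots> = (\<Sum>x\<in>V. \<Sum>y\<in>nb x. \<bar>f x\<bar> - sg (f x) * sg (f y) * \<bar>f y\<bar>)"
    unfolding sum_distrib_left
    by (intro sum.cong) (simp_all add: right_diff_distrib sg_mult_abs mult.assoc)
  also have "\<dots> = (\<Sum>x\<in>V. \<Sum>y\<in>nb x. \<bar>f x\<bar>) - (\<Sum>x\<in>V. \<Sum>y\<in>nb x. sg (f x) * sg (f y) * \<bar>f y\<bar>)"
    by (simp add: sum_subtractf)
  also have "(\<Sum>x\<in>V. \<Sum>y\<in>nb x. sg (f x) * sg (f y) * \<bar>f y\<bar>)
      = (\<Sum>x\<in>V. \<Sum>y\<in>nb x. sg (f y) * sg (f x) * \<bar>f x\<bar>)"
    by (rule sum_nb_swap)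
  also have "(\<Sum>x\<in>V. \<Sum>y\<in>nb x. \<bar>f x\<bar>) - \<dots>
      = (\<Sum>x\<in>V. \<Sum>y\<in>nb x. (1 - sg (f x) * sg (f y)) * \<bar>f x\<bar>)"
    unfolding sum_subtractf[symmetric] by (intro sum.cong) (simp_all add: algebra_simps)
  finally show ?thesis by simp
qed

text \<open>By \<open>sign_flow\<close> the sign-changing edges of \<open>f\<close> have total
  weight 1, and each unit of weight may be charged \<open>c\<close>. If \<open>h\<close> changes
  sign on the edge as well, then \<open>\<bar>h x\<bar> + \<bar>h y\<bar>\<close> is an oscillation
  of \<open>h\<close>, which leaves room for the diagonal products
  \<open>\<bar>f x * h x\<bar>\<close>.\<close>

lemma budget:
  assumes osc: "\<And>x y. x \<in> V \<Longrightarrow> y \<in> V \<Longrightarrow> h x - h y \<le> c" and c: "\<And>x. x \<in> V \<Longrightarrow> \<bar>h x\<bar> \<le> c"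
  shows "(\<Sum>x\<in>V. \<Sum>y\<in>nb x. (1 - sg (f x) * sg (f y)) / 2 * (\<bar>f x\<bar> * \<bar>h y\<bar>)
      + (1 - sg (f x) * sg (f y)) * (1 - sg (h x) * sg (h y)) / 4 * \<bar>f x * h x\<bar>) \<le> c"
proof -
  let ?k = "\<lambda>x y. (1 - sg (f x) * sg (f y)) / 2 * (\<bar>f x\<bar> * \<bar>h y\<bar>)
      + (1 - sg (f x) * sg (f y)) * (1 - sg (h x) * sg (h y)) / 4 * \<bar>f x * h x\<bar>"
  let ?r = "\<lambda>x y. (1 - sg (f x) * sg (f y)) * \<bar>f x\<bar> * c / 2"
  have "2 * (\<Sum>x\<in>V. \<Sum>y\<in>nb x. ?k x y) = (\<Sum>x\<in>V. \<Sum>y\<in>nb x. ?k x y + ?k y x)"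
    using sum_nb_swap[of ?k] by (simp add: sum.distrib)
  also have "\<dots> \<le> (\<Sum>x\<in>V. \<Sum>y\<in>nb x. ?r x y + ?r y x)"
  proof (intro sum_mono)
    fix x y assume x: "x \<in> V" and "y \<in> nb x"
    then have y: "y \<in> V" by (auto simp: nbs_def)
    show "?k x y + ?k y x \<le> ?r x y + ?r y x"
    proof (cases "sg (f x) * sg (f y) = 1")
      case True
      then show ?thesis by (simp add: mult.commute)
    next
      case False
      then have m: "sg (f x) * sg (f y) = -1" by (auto simp: sg_def split: if_splits)
      show ?thesis
      proof (cases "sg (h x) * sg (h y) = 1")
        case True
        have "\<bar>f x\<bar> * \<bar>h y\<bar> \<le> \<bar>f x\<bar> * c" "\<bar>f y\<bar> * \<bar>h x\<bar> \<le> \<bar>f y\<bar> * c"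
          using c x y by (auto intro!: mult_left_mono)
        then show ?thesis using m True by (simp add: mult.commute)
      next
        case False
        then have m2: "sg (h x) * sg (h y) = -1" by (auto simp: sg_def split: if_splits)
        then have "\<bar>h x\<bar> + \<bar>h y\<bar> \<le> c"
          using osc[OF x y] osc[OF y x] by (auto simp: sg_def split: if_splits)
        then have "(\<bar>f x\<bar> + \<bar>f y\<bar>) * (\<bar>h x\<bar> + \<bar>h y\<bar>) \<le> (\<bar>f x\<bar> + \<bar>f y\<bar>) * c"
          by (intro mult_left_mono) auto
        then show ?thesis using m m2 by (simp add: algebra_simps abs_mult)
      qed
    qed
  qed
  also have "\<dots> = 2 * (\<Sum>x\<in>V. \<Sum>y\<in>nb x. ?r x y)"
    using sum_nb_swap[of ?r] by (simp add: sum.distrib)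
  also have "\<dots> = c * (\<Sum>x\<in>V. \<Sum>y\<in>nb x. (1 - sg (f x) * sg (f y)) * \<bar>f x\<bar>)"
    unfolding sum_distrib_left by (intro sum.cong) simp_all
  also have "\<dots> = 2 * c" using sign_flow by simp
  finally show ?thesis by simp
qed

text \<open>Sharpens \<open>deg_bound\<close>: nonneighbours with the sign of \<open>f x\<close> act
  against the others in \<open>deg_eq_nn\<close>, so their mass comes on top of the degree
  term.\<close>

lemma deg_bound_sign:
  assumes "x \<in> Z" "Z \<subseteq> V" and sgn: "\<And>y. y \<in> Z \<Longrightarrow> sg (f y) = p"
  shows "card (nb x) * \<bar>f x\<bar> + (\<Sum>y\<in>nn x. \<bar>f y\<bar> * of_bool (y \<in> Z)) \<le> 1"
proof -
  have p: "p = 1 \<or> p = -1" using sgn[OF assms(1)] by (auto simp: sg_def split: if_splits)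
  have "card (nb x) * \<bar>f x\<bar> = p * (card (nb x) * f x)"
    using sg_mult_abs(2)[of "f x"] sgn[OF assms(1)] by simp
  also have "\<dots> = (\<Sum>y\<in>nn x. - p * f y)"
    using deg_eq_nn[of x] assms by (auto simp: sum_distrib_left sum_negf)
  also have "\<dots> \<le> (\<Sum>y\<in>nn x. ppart (- p * f y) - \<bar>f y\<bar> * of_bool (y \<in> Z))"
  proof (rule sum_mono)
    fix y
    have "p * f y = \<bar>f y\<bar>" if "y \<in> Z" using sgn[OF that] sg_mult_abs(2)[of "f y"] by simp
    then show "- p * f y \<le> ppart (- p * f y) - \<bar>f y\<bar> * of_bool (y \<in> Z)"
      by (cases "y \<in> Z") auto
  qed
  also have "\<dots> = (\<Sum>y\<in>nn x. ppart (- p * f y)) - (\<Sum>y\<in>nn x. \<bar>f y\<bar> * of_bool (y \<in> Z))"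
    by (rule sum_subtractf)
  also have "(\<Sum>y\<in>nn x. ppart (- p * f y)) \<le> 1"
    using p sum_ppart_le[of "nn x"] by (auto simp: nbs_subset)
  finally show ?thesis by simp
qed

end

section \<open>An eigenfunction of the graph and one of its complement\<close>

locale fiedler_pair = F: fiedler V A f + G: fiedler V "\<lambda>x y. \<not> A x y" g for V A f g +
  assumes orth: "(\<Sum>x\<in>V. f x * g x) = 0" and card_V: "3 \<le> card V"
begin

abbreviation nb where "nb \<equiv> nbs V A"
abbreviation nn where "nn \<equiv> nbs V (\<lambda>x y. \<not> A x y)"

lemma card_nb_nn: "x \<in> V \<Longrightarrow> real (card (nb x)) + real (card (nn x)) = real (card V) - 1"
  using card_nbs_compl[OF F.fin, of x A] by linarith

text \<open>Exchanging \<open>x\<close> and \<open>y\<close> in the sum over non-edges gives both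
  sums the same summand; edges and non-edges together are all ordered pairs off the
  diagonal.\<close>

lemma sum_cross:
  assumes "\<And>x y. h x y = h y x"
  shows "(\<Sum>x\<in>V. \<Sum>y\<in>nb x. \<bar>f x\<bar> * \<bar>g y\<bar> * h x y) + (\<Sum>x\<in>V. \<Sum>y\<in>nn x. \<bar>g x\<bar> * \<bar>f y\<bar> * h x y)
    = (\<Sum>x\<in>V. \<Sum>y\<in>V. \<bar>f x\<bar> * \<bar>g y\<bar> * h x y) - (\<Sum>x\<in>V. \<bar>f x\<bar> * \<bar>g x\<bar> * h x x)"
proof -
  have "(\<Sum>x\<in>V. \<Sum>y\<in>nn x. \<bar>g x\<bar> * \<bar>f y\<bar> * h x y) = (\<Sum>x\<in>V. \<Sum>y\<in>nn x. \<bar>g y\<bar> * \<bar>f x\<bar> * h y x)"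
    by (rule G.sum_nb_swap)
  also have "\<dots> = (\<Sum>x\<in>V. \<Sum>y\<in>nn x. \<bar>f x\<bar> * \<bar>g y\<bar> * h x y)"
    using assms by (simp add: mult.commute)
  finally have "(\<Sum>x\<in>V. \<Sum>y\<in>nb x. \<bar>f x\<bar> * \<bar>g y\<bar> * h x y) + (\<Sum>x\<in>V. \<Sum>y\<in>nn x. \<bar>g x\<bar> * \<bar>f y\<bar> * h x y)
    = (\<Sum>x\<in>V. (\<Sum>y\<in>nb x. \<bar>f x\<bar> * \<bar>g y\<bar> * h x y) + (\<Sum>y\<in>nn x. \<bar>f x\<bar> * \<bar>g y\<bar> * h x y))"
    by (simp add: sum.distrib)
  also have "\<dots> = (\<Sum>x\<in>V. (\<Sum>y\<in>V. \<bar>f x\<bar> * \<bar>g y\<bar> * h x y) - \<bar>f x\<bar> * \<bar>g x\<bar> * h x x)"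
    by (intro sum.cong F.sum_nb_nn_eq) auto
  finally show ?thesis by (simp add: sum_subtractf)
qed

text \<open>Weight \<open>deg_bound_sign\<close> for \<open>f\<close> by
  \<open>\<bar>g x\<bar>\<close>, that for \<open>g\<close> by \<open>\<bar>f x\<bar>\<close>, and
  sum over \<open>Z\<close>. The degrees add up to \<open>card V - 1\<close> and the cross terms to
  \<open>SF * SG - W\<close>, so the bound is \<open>SF + SG - SF * SG\<close>, which is at most
  1.\<close>

lemma quadrant_bound:
  assumes Z: "Z \<subseteq> V" and p: "\<And>y. y \<in> Z \<Longrightarrow> sg (f y) = p" and q: "\<And>y. y \<in> Z \<Longrightarrow> sg (g y) = q"
  shows "(real (card V) - 2) * (\<Sum>x\<in>Z. \<bar>f x\<bar> * \<bar>g x\<bar>) \<le> 1"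
proof -
  let ?z = "\<lambda>x. of_bool (x \<in> Z) :: real"
  have on: "(\<Sum>x\<in>V. k x * ?z x) = (\<Sum>x\<in>Z. k x)" for k
  proof -
    have "(\<Sum>x\<in>Z. k x) = (\<Sum>x\<in>Z. k x * ?z x)" by (rule sum.cong) auto
    also have "\<dots> = (\<Sum>x\<in>V. k x * ?z x)" using Z F.fin by (intro sum.mono_neutral_left) auto
    finally show ?thesis ..
  qed
  define SF where "SF = (\<Sum>x\<in>Z. \<bar>f x\<bar>)"
  define SG where "SG = (\<Sum>x\<in>Z. \<bar>g x\<bar>)"
  define W where "W = (\<Sum>x\<in>Z. \<bar>f x\<bar> * \<bar>g x\<bar>)"
  have le1: "(\<Sum>x\<in>Z. \<bar>k x\<bar>) \<le> 1"
    if k: "fiedler V B k" "\<And>y. y \<in> Z \<Longrightarrow> sg (k y) = r" for B k r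
  proof (cases "r = 1")
    case True
    then have "0 < k y" if "y \<in> Z" for y
      using k(2)[OF that] by (simp add: sg_def split: if_splits)
    then have "(\<Sum>x\<in>Z. \<bar>k x\<bar>) = (\<Sum>x\<in>Z. ppart (k x))"
      by (intro sum.cong) fastforce+
    then show ?thesis using fiedler.sum_ppart_le[OF k(1) Z] by simp
  next
    case False
    then have "k y \<le> 0" if "y \<in> Z" for y
      using k(2)[OF that] by (auto simp: sg_def split: if_splits)
    then have "(\<Sum>x\<in>Z. \<bar>k x\<bar>) = (\<Sum>x\<in>Z. ppart (- k x))"
      by (intro sum.cong) fastforce+
    then show ?thesis using fiedler.sum_ppart_le[OF k(1) Z] by simp
  qed
  have le: "SF \<le> 1" "SG \<le> 1"
    unfolding SF_def SG_def using le1[OF F.fiedler_axioms p] le1[OF G.fiedler_axioms q] by auto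
  have "(\<Sum>x\<in>Z. \<bar>g x\<bar> * (card (nb x) * \<bar>f x\<bar> + (\<Sum>y\<in>nn x. \<bar>f y\<bar> * ?z y)))
     + (\<Sum>x\<in>Z. \<bar>f x\<bar> * (card (nn x) * \<bar>g x\<bar> + (\<Sum>y\<in>nb x. \<bar>g y\<bar> * ?z y)))
     \<le> (\<Sum>x\<in>Z. \<bar>g x\<bar> * 1) + (\<Sum>x\<in>Z. \<bar>f x\<bar> * 1)"
    using F.deg_bound_sign[OF _ Z p] G.deg_bound_sign[OF _ Z q]
    by (intro add_mono sum_mono mult_left_mono) auto
  also have "\<dots> = SF + SG" by (simp add: SF_def SG_def)
  also have "(\<Sum>x\<in>Z. \<bar>g x\<bar> * (card (nb x) * \<bar>f x\<bar> + (\<Sum>y\<in>nn x. \<bar>f y\<bar> * ?z y)))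
     + (\<Sum>x\<in>Z. \<bar>f x\<bar> * (card (nn x) * \<bar>g x\<bar> + (\<Sum>y\<in>nb x. \<bar>g y\<bar> * ?z y)))
     = (\<Sum>x\<in>Z. (real (card (nb x)) + real (card (nn x))) * (\<bar>f x\<bar> * \<bar>g x\<bar>))
     + ((\<Sum>x\<in>Z. \<Sum>y\<in>nb x. \<bar>f x\<bar> * \<bar>g y\<bar> * ?z y) + (\<Sum>x\<in>Z. \<Sum>y\<in>nn x. \<bar>g x\<bar> * \<bar>f y\<bar> * ?z y))"
    by (simp add: algebra_simps sum.distrib sum_distrib_left)
  also have "(\<Sum>x\<in>Z. (real (card (nb x)) + real (card (nn x))) * (\<bar>f x\<bar> * \<bar>g x\<bar>)) = (real (card V) - 1) * W"
    unfolding W_def sum_distrib_left using Z card_nb_nn by (intro sum.cong) auto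
  also have "(\<Sum>x\<in>Z. \<Sum>y\<in>nb x. \<bar>f x\<bar> * \<bar>g y\<bar> * ?z y) + (\<Sum>x\<in>Z. \<Sum>y\<in>nn x. \<bar>g x\<bar> * \<bar>f y\<bar> * ?z y)
     = (\<Sum>x\<in>V. \<Sum>y\<in>nb x. \<bar>f x\<bar> * \<bar>g y\<bar> * (?z x * ?z y)) + (\<Sum>x\<in>V. \<Sum>y\<in>nn x. \<bar>g x\<bar> * \<bar>f y\<bar> * (?z x * ?z y))"
    unfolding on[symmetric] by (simp add: sum_distrib_left sum_distrib_right mult_ac)
  also have "\<dots> = (\<Sum>x\<in>V. \<Sum>y\<in>V. \<bar>f x\<bar> * \<bar>g y\<bar> * (?z x * ?z y)) - (\<Sum>x\<in>V. \<bar>f x\<bar> * \<bar>g x\<bar> * (?z x * ?z x))"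
    by (rule sum_cross) (rule mult.commute)
  also have "(\<Sum>x\<in>V. \<bar>f x\<bar> * \<bar>g x\<bar> * (?z x * ?z x)) = W"
    unfolding W_def on[symmetric] by (intro sum.cong) auto
  also have "(\<Sum>x\<in>V. \<Sum>y\<in>V. \<bar>f x\<bar> * \<bar>g y\<bar> * (?z x * ?z y)) = SF * SG"
    unfolding SF_def SG_def on[symmetric] sum_product by (simp add: mult_ac)
  finally have "(real (card V) - 2) * W \<le> SF + SG - SF * SG" by (simp add: algebra_simps)
  also have "\<dots> = 1 - (1 - SF) * (1 - SG)" by (simp add: algebra_simps)
  also have "\<dots> \<le> 1" using le by simp
  finally show ?thesis by (simp add: W_def)
qed

text \<open>Counting the flow of \<open>f\<close> over the edges and of \<open>g\<close> over the non-edges gives \<open>c + c'\<close> as an upper bound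
  for \<open>2\<close> minus a sum over the four sign classes \<open>Z\<close> of \<open>(f, g)\<close>, in which \<open>Z\<close> contributes
  \<open>card Z - 1\<close> times the sum of \<open>\<bar>f x * g x\<bar>\<close> over \<open>Z\<close>.\<close>

lemma osc_sum:
  assumes osc_f: "\<And>x y. x \<in> V \<Longrightarrow> y \<in> V \<Longrightarrow> f x - f y \<le> c" "\<And>x. x \<in> V \<Longrightarrow> \<bar>f x\<bar> \<le> c"
    and osc_g: "\<And>x y. x \<in> V \<Longrightarrow> y \<in> V \<Longrightarrow> g x - g y \<le> c'" "\<And>x. x \<in> V \<Longrightarrow> \<bar>g x\<bar> \<le> c'"
  shows "1 \<le> c + c'"
proof -
  define n where "n = real (card V)"
  have n: "3 \<le> n" using card_V by (simp add: n_def)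
  define \<sigma> where "\<sigma> x = sg (f x)" for x
  define \<tau> where "\<tau> x = sg (g x)" for x
  define a where "a x = \<bar>f x\<bar>" for x
  define b where "b x = \<bar>g x\<bar>" for x
  define W where "W = (\<Sum>x\<in>V. a x * b x)"
  have sq [simp]: "\<sigma> x * \<sigma> x = 1" "\<tau> x * \<tau> x = 1" for x by (simp_all add: \<sigma>_def \<tau>_def)
  have fa: "f x = \<sigma> x * a x" "g x = \<tau> x * b x" for x
    by (simp_all add: \<sigma>_def \<tau>_def a_def b_def sg_mult_abs)
  define M1 where "M1 = (\<Sum>x\<in>V. \<Sum>y\<in>nb x. a x * b y)"
  define M2 where "M2 = (\<Sum>x\<in>V. \<Sum>y\<in>nn x. b x * a y)"
  define L1 where "L1 = (\<Sum>x\<in>V. \<Sum>y\<in>nb x. a x * b y * (\<sigma> x * \<sigma> y))"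
  define L2 where "L2 = (\<Sum>x\<in>V. \<Sum>y\<in>nn x. b x * a y * (\<tau> x * \<tau> y))"
  define K1 where "K1 = (\<Sum>x\<in>V. \<Sum>y\<in>nb x. a x * b y * (\<tau> x * \<tau> y))"
  define K2 where "K2 = (\<Sum>x\<in>V. \<Sum>y\<in>nn x. b x * a y * (\<sigma> x * \<sigma> y))"
  \<comment> \<open>\<open>R\<close> collects the pairs that differ in both signs, \<open>Q\<close>
    the pairs in the same sign class.\<close>
  define R where "R = (\<Sum>x\<in>V. \<Sum>y\<in>V. (1 - \<sigma> x * \<sigma> y) * (1 - \<tau> x * \<tau> y) / 4 * (a x * b x))"
  define Q where "Q = (\<Sum>x\<in>V. \<Sum>y\<in>V. (1 + \<sigma> x * \<sigma> y) * (1 + \<tau> x * \<tau> y) / 4 * (a x * b x))"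
  have s2: "(\<Sum>x\<in>V. a x) = 2" "(\<Sum>x\<in>V. b x) = 2"
    using F.sumabs G.sumabs by (simp_all add: a_def b_def)
  have s0: "(\<Sum>x\<in>V. \<sigma> x * a x) = 0" "(\<Sum>x\<in>V. \<tau> x * b x) = 0"
    using F.sum0 G.sum0 by (simp_all add: fa[symmetric])
  have M: "M1 + M2 = 4 - W"
  proof -
    have "M1 + M2 = (\<Sum>x\<in>V. \<Sum>y\<in>V. a x * b y) - W"
      using sum_cross[of "\<lambda>x y. 1"] by (simp add: M1_def M2_def W_def a_def b_def)
    also have "(\<Sum>x\<in>V. \<Sum>y\<in>V. a x * b y) = 4" unfolding sum_product[symmetric] s2 by simp
    finally show ?thesis .
  qed
  have LK1: "L1 + K2 = - W"
  proof -
    have "L1 + K2 = (\<Sum>x\<in>V. \<Sum>y\<in>V. a x * b y * (\<sigma> x * \<sigma> y)) - W"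
      using sum_cross[of "\<lambda>x y. \<sigma> x * \<sigma> y"] by (simp add: L1_def K2_def W_def a_def b_def mult.commute)
    also have "(\<Sum>x\<in>V. \<Sum>y\<in>V. a x * b y * (\<sigma> x * \<sigma> y)) = (\<Sum>x\<in>V. \<sigma> x * a x) * (\<Sum>y\<in>V. \<sigma> y * b y)"
      unfolding sum_product by (simp add: mult_ac)
    finally show ?thesis using s0 by simp
  qed
  have LK2: "K1 + L2 = - W"
  proof -
    have "K1 + L2 = (\<Sum>x\<in>V. \<Sum>y\<in>V. a x * b y * (\<tau> x * \<tau> y)) - W"
      using sum_cross[of "\<lambda>x y. \<tau> x * \<tau> y"] by (simp add: K1_def L2_def W_def a_def b_def mult.commute)
    also have "(\<Sum>x\<in>V. \<Sum>y\<in>V. a x * b y * (\<tau> x * \<tau> y)) = (\<Sum>x\<in>V. \<tau> x * a x) * (\<Sum>y\<in>V. \<tau> y * b y)"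
      unfolding sum_product by (simp add: mult_ac)
    finally show ?thesis using s0 by simp
  qed
  \<comment> \<open>The eigenvalue equations turn the inner sums into degrees, and the two degrees
    of \<open>x\<close> add up to \<open>n - 1\<close>.\<close>
  have K: "K1 + K2 = - (n - 1) * W"
  proof -
    have "(\<Sum>y\<in>nb x. a x * b y * (\<tau> x * \<tau> y)) + (\<Sum>y\<in>nn x. b x * a y * (\<sigma> x * \<sigma> y)) = - (n - 1) * (a x * b x)"
      if x: "x \<in> V" for x
    proof -
      have "(\<Sum>y\<in>nn x. b x * a y * (\<sigma> x * \<sigma> y)) = b x * \<sigma> x * (\<Sum>y\<in>nn x. f y)"
        unfolding sum_distrib_left by (simp add: fa mult_ac)
      also have "\<dots> = - (card (nb x) * (\<sigma> x * f x)) * b x"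
        using F.deg_eq_nn[OF x] by (simp add: algebra_simps)
      also have "\<sigma> x * f x = a x" by (simp add: \<sigma>_def a_def sg_mult_abs)
      finally have 1: "(\<Sum>y\<in>nn x. b x * a y * (\<sigma> x * \<sigma> y)) = - (card (nb x) * (a x * b x))" by simp
      have "(\<Sum>y\<in>nb x. a x * b y * (\<tau> x * \<tau> y)) = a x * \<tau> x * (\<Sum>y\<in>nb x. g y)"
        unfolding sum_distrib_left by (simp add: fa mult_ac)
      also have "\<dots> = - (card (nn x) * (\<tau> x * g x)) * a x"
        using G.deg_eq_nn[OF x] by (simp add: algebra_simps)
      also have "\<tau> x * g x = b x" by (simp add: \<tau>_def b_def sg_mult_abs)
      finally have 2: "(\<Sum>y\<in>nb x. a x * b y * (\<tau> x * \<tau> y)) = - (card (nn x) * (a x * b x))" by simp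
      have "n - 1 = real (card (nb x)) + real (card (nn x))" using card_nb_nn[OF x] by (simp add: n_def)
      then show ?thesis unfolding 1 2 by (simp add: algebra_simps)
    qed
    then show ?thesis
      unfolding K1_def K2_def W_def sum_distrib_left sum.distrib[symmetric] by (intro sum.cong) auto
  qed
  have "(\<Sum>x\<in>V. \<Sum>y\<in>nb x. (1 - \<sigma> x * \<sigma> y) / 2 * (a x * b y) + (1 - \<sigma> x * \<sigma> y) * (1 - \<tau> x * \<tau> y) / 4 * (a x * b x))
    + (\<Sum>x\<in>V. \<Sum>y\<in>nn x. (1 - \<tau> x * \<tau> y) / 2 * (b x * a y) + (1 - \<sigma> x * \<sigma> y) * (1 - \<tau> x * \<tau> y) / 4 * (a x * b x))
    \<le> c' + c"
    using F.budget[of g c'] G.budget[of f c] assms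
    by (simp add: \<sigma>_def \<tau>_def a_def b_def abs_mult mult_ac)
  moreover have "(\<Sum>x\<in>V. \<Sum>y\<in>nb x. (1 - \<sigma> x * \<sigma> y) / 2 * (a x * b y) + (1 - \<sigma> x * \<sigma> y) * (1 - \<tau> x * \<tau> y) / 4 * (a x * b x))
    = (M1 - L1) / 2 + (\<Sum>x\<in>V. \<Sum>y\<in>nb x. (1 - \<sigma> x * \<sigma> y) * (1 - \<tau> x * \<tau> y) / 4 * (a x * b x))"
  proof -
    have "(M1 - L1) / 2 = (\<Sum>x\<in>V. \<Sum>y\<in>nb x. (1 - \<sigma> x * \<sigma> y) / 2 * (a x * b y))"
      unfolding M1_def L1_def sum_subtractf[symmetric] sum_divide_distrib
      by (intro sum.cong) (simp_all add: algebra_simps diff_divide_distrib)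
    then show ?thesis by (simp only: sum.distrib)
  qed
  moreover have "(\<Sum>x\<in>V. \<Sum>y\<in>nn x. (1 - \<tau> x * \<tau> y) / 2 * (b x * a y) + (1 - \<sigma> x * \<sigma> y) * (1 - \<tau> x * \<tau> y) / 4 * (a x * b x))
    = (M2 - L2) / 2 + (\<Sum>x\<in>V. \<Sum>y\<in>nn x. (1 - \<sigma> x * \<sigma> y) * (1 - \<tau> x * \<tau> y) / 4 * (a x * b x))"
  proof -
    have "(M2 - L2) / 2 = (\<Sum>x\<in>V. \<Sum>y\<in>nn x. (1 - \<tau> x * \<tau> y) / 2 * (b x * a y))"
      unfolding M2_def L2_def sum_subtractf[symmetric] sum_divide_distrib
      by (intro sum.cong) (simp_all add: algebra_simps diff_divide_distrib)
    then show ?thesis by (simp only: sum.distrib)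
  qed
  moreover have "(\<Sum>x\<in>V. \<Sum>y\<in>nb x. (1 - \<sigma> x * \<sigma> y) * (1 - \<tau> x * \<tau> y) / 4 * (a x * b x))
    + (\<Sum>x\<in>V. \<Sum>y\<in>nn x. (1 - \<sigma> x * \<sigma> y) * (1 - \<tau> x * \<tau> y) / 4 * (a x * b x)) = R"
    unfolding R_def sum.distrib[symmetric]
    by (rule sum.cong) (simp_all add: F.sum_nb_nn_eq)
  ultimately have 1: "(M1 - L1) / 2 + (M2 - L2) / 2 + R \<le> c + c'" by linarith
  \<comment> \<open>The two weights add up to half of one plus the product of all four signs. The
    product part contains the factor \<open>f x * g x\<close> and vanishes by orthogonality.\<close>
  have RQ: "R + Q = n * W / 2"
  proof -
    have "R + Q = (\<Sum>x\<in>V. \<Sum>y\<in>V. a x * b x / 2 + (\<sigma> x * a x * (\<tau> x * b x)) * (\<sigma> y * \<tau> y) / 2)"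
      unfolding R_def Q_def sum.distrib[symmetric]
      by (intro sum.cong) (simp_all add: field_simps)
    also have "\<dots> = (\<Sum>x\<in>V. n * (a x * b x) / 2) + (\<Sum>x\<in>V. \<Sum>y\<in>V. (f x * g x) * (\<sigma> y * \<tau> y)) / 2"
      unfolding sum.distrib fa by (simp add: n_def sum_divide_distrib)
    also have "(\<Sum>x\<in>V. \<Sum>y\<in>V. (f x * g x) * (\<sigma> y * \<tau> y)) = 0"
      unfolding sum_product[symmetric] orth by simp
    also have "(\<Sum>x\<in>V. n * (a x * b x) / 2) = n * W / 2"
      unfolding W_def sum_distrib_left sum_divide_distrib ..
    finally show ?thesis by simp
  qed
  have QW: "Q - W \<le> 1"
  proof -
    define cls where "cls x = (0 < f x, 0 < g x)" for x
    define Z where "Z k = {x \<in> V. cls x = k}" for k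
    have fZ: "finite (Z k)" for k using F.fin by (simp add: Z_def)
    have grp: "(\<Sum>x\<in>V. h x) = (\<Sum>k\<in>UNIV. \<Sum>x\<in>Z k. h x)" for h :: "_ \<Rightarrow> real"
      unfolding Z_def by (rule sum.group[symmetric]) (auto simp: F.fin)
    have row: "(\<Sum>y\<in>V. (1 + \<sigma> x * \<sigma> y) * (1 + \<tau> x * \<tau> y) / 4 * (a x * b x)) = card (Z (cls x)) * (a x * b x)" for x
    proof -
      have "(\<Sum>y\<in>V. (1 + \<sigma> x * \<sigma> y) * (1 + \<tau> x * \<tau> y) / 4 * (a x * b x))
        = (\<Sum>y\<in>V. if cls y = cls x then a x * b x else 0)"
        by (rule sum.cong) (auto simp: \<sigma>_def \<tau>_def sg_def cls_def)
      then show ?thesis by (simp add: Z_def sum.inter_filter[symmetric] F.fin)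
    qed
    have bnd: "(real (card (Z k)) - 1) * (\<Sum>x\<in>Z k. a x * b x) \<le> (real (card (Z k)) - of_bool (Z k \<noteq> {})) / (n - 2)" for k
    proof (cases "Z k = {}")
      case False
      then have c: "1 \<le> card (Z k)" using fZ by (simp add: Suc_le_eq card_gt_0_iff)
      have "(n - 2) * (\<Sum>x\<in>Z k. a x * b x) \<le> 1"
        unfolding n_def a_def b_def
        by (rule quadrant_bound[of _ "if fst k then 1 else -1" "if snd k then 1 else -1"])
          (auto simp: Z_def cls_def sg_def)
      then have "(\<Sum>x\<in>Z k. a x * b x) \<le> 1 / (n - 2)" using n by (simp add: field_simps)
      then have "(real (card (Z k)) - 1) * (\<Sum>x\<in>Z k. a x * b x) \<le> (real (card (Z k)) - 1) * (1 / (n - 2))"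
        using c by (intro mult_left_mono) auto
      then show ?thesis using False by simp
    qed simp
    have "Q - W = (\<Sum>x\<in>V. (real (card (Z (cls x))) - 1) * (a x * b x))"
      unfolding Q_def W_def row sum_subtractf[symmetric] by (simp add: left_diff_distrib)
    also have "\<dots> = (\<Sum>k\<in>UNIV. (real (card (Z k)) - 1) * (\<Sum>x\<in>Z k. a x * b x))"
      unfolding grp sum_distrib_left by (intro sum.cong) (auto simp: Z_def)
    also have "\<dots> \<le> (\<Sum>k\<in>UNIV. (real (card (Z k)) - of_bool (Z k \<noteq> {})) / (n - 2))"
      by (intro sum_mono bnd)
    also have "\<dots> = ((\<Sum>k\<in>UNIV. real (card (Z k))) - (\<Sum>k\<in>UNIV. of_bool (Z k \<noteq> {}))) / (n - 2)"
      by (simp add: sum_divide_distrib[symmetric] sum_subtractf)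
    also have "(\<Sum>k\<in>UNIV. real (card (Z k))) = n"
      using grp[of "\<lambda>x. 1"] by (simp add: n_def)
    \<comment> \<open>\<open>f\<close> takes positive and nonpositive values, so at least two sign
      classes are nonempty, each of which saves one.\<close>
    also have "(n - (\<Sum>k\<in>UNIV. of_bool (Z k \<noteq> {}))) / (n - 2) \<le> (n - 2) / (n - 2)"
    proof -
      have "\<exists>x\<in>V. 0 < f x"
      proof (rule ccontr)
        assume "\<not> ?thesis"
        then have "(\<Sum>x\<in>V. ppart (f x)) = (\<Sum>x\<in>V. 0)" by (intro sum.cong) force+
        then show False using F.sum_ppart by simp
      qed
      then obtain x where x: "x \<in> V" "0 < f x" by blast
      have "\<exists>x\<in>V. \<not> 0 < f x"
      proof (rule ccontr)
        assume "\<not> ?thesis"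
        then have "(\<Sum>x\<in>V. ppart (- f x)) = (\<Sum>x\<in>V. 0)" by (intro sum.cong) force+
        then show False using F.sum_ppart by simp
      qed
      then obtain y where y: "y \<in> V" "\<not> 0 < f y" by blast
      have "cls x \<noteq> cls y" using x y by (simp add: cls_def)
      moreover have "Z (cls x) \<noteq> {}" "Z (cls y) \<noteq> {}" using x y by (auto simp: Z_def)
      ultimately have "2 = (\<Sum>k\<in>{cls x, cls y}. of_bool (Z k \<noteq> {}) :: real)"
        by (subst sum.insert) (auto simp del: sum_of_bool_eq)
      also have "\<dots> \<le> (\<Sum>k\<in>UNIV. of_bool (Z k \<noteq> {}))" by (intro sum_mono2) auto
      finally show ?thesis using n by (intro divide_right_mono) auto
    qed
    also have "\<dots> = 1" using n by simp
    finally show ?thesis .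
  qed
  \<comment> \<open>The terms with \<open>n * W\<close> cancel, since
    \<open>L1 + L2 = (n - 3) * W\<close> and \<open>R + Q = n * W / 2\<close>.\<close>
  have "(M1 - L1) / 2 + (M2 - L2) / 2 + R = 2 + W - Q"
  proof -
    have nW: "(n - 1) * W = n * W - W" by (simp add: algebra_simps)
    show ?thesis using M LK1 LK2 K RQ nW by (simp add: field_simps)
  qed
  then show ?thesis using 1 QW by linarith
qed

end

section \<open>The path of extreme vertices\<close>

locale extremal_path = fiedler_pair V A f g for V A f g +
  fixes v w s t
  assumes card32: "32 \<le> card V"
    and tc: "two_connected V A" "two_connected V (\<lambda>x y. \<not> A x y)"
    and mem: "v \<in> V" "w \<in> V" "s \<in> V" "t \<in> V"
    and dist: "v \<noteq> w" "v \<noteq> s" "v \<noteq> t" "w \<noteq> s" "w \<noteq> t" "s \<noteq> t"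
    and f_le: "\<And>x. x \<in> V \<Longrightarrow> f x \<le> f v" "\<And>x. x \<in> V \<Longrightarrow> f w \<le> f x"
    and g_le: "\<And>x. x \<in> V \<Longrightarrow> g x \<le> g s" "\<And>x. x \<in> V \<Longrightarrow> g t \<le> g x"
    and path: "A v t" "A w s" "A s t" "\<not> A v w" "\<not> A v s" "\<not> A w t"
begin

text \<open>The path on four vertices is isomorphic to its complement: the non-edges of v - t - s -
  w form the path s - v - w - t. The sign of \<open>f\<close> has to change because \<open>w\<close>
  takes the role of the maximum and \<open>v\<close> that of the minimum.\<close>

lemma rotate: "extremal_path V (\<lambda>x y. \<not> A x y) g (\<lambda>x. - f x) s t w v"
proof -
  have "fiedler V (\<lambda>x y. \<not> \<not> A x y) (\<lambda>x. - f x)" using F.fiedler_uminus by simp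
  moreover have "(\<Sum>x\<in>V. g x * - f x) = 0"
    using orth by (simp add: sum_negf mult.commute)
  ultimately show ?thesis
    using G.fiedler_axioms card_V card32 tc mem dist f_le g_le path F.sym
    unfolding extremal_path_def extremal_path_axioms_def fiedler_pair_def fiedler_pair_axioms_def
    by auto
qed

lemma mem_nb: "t \<in> nb v" "v \<in> nb t" "s \<in> nb w" "w \<in> nb s" "s \<in> nb t" "t \<in> nb s"
  using mem dist path F.sym by (auto simp: nbs_def)

lemma mem_nn: "w \<in> nn v" "v \<in> nn w" "s \<in> nn v" "v \<in> nn s" "w \<in> nn t" "t \<in> nn w"
  using mem dist path F.sym by (auto simp: nbs_def)

lemma deficit: "(\<Sum>y\<in>nb v. f v - f y) = f v" "(\<Sum>y\<in>nb w. f y - f w) = - f w"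
  "(\<Sum>y\<in>nn s. g s - g y) = g s" "(\<Sum>y\<in>nn t. g y - g t) = - g t"
  using F.eig[OF mem(1)] F.eig[OF mem(2)] G.eig[OF mem(3)] G.eig[OF mem(4)]
  by (simp_all add: sum_subtractf)

text \<open>A single nonnegative deficit is at most the sum of all deficits:
  \<open>f v - f t \<le> f v\<close>, and likewise at the other three vertices.\<close>

lemma signs: "0 \<le> f t" "f s \<le> 0" "0 \<le> g v" "g w \<le> 0"
proof -
  have V: "y \<in> V" if "y \<in> nbs V B x" for B x y using that by (simp add: nbs_def)
  have "f v - f t \<le> (\<Sum>y\<in>nb v. f v - f y)"
    by (rule member_le_sum[OF mem_nb(1)]) (use V f_le F.fin in auto)
  then show "0 \<le> f t" using deficit by simp
  have "f s - f w \<le> (\<Sum>y\<in>nb w. f y - f w)"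
    by (rule member_le_sum[OF mem_nb(3)]) (use V f_le F.fin in auto)
  then show "f s \<le> 0" using deficit by simp
  have "g s - g v \<le> (\<Sum>y\<in>nn s. g s - g y)"
    by (rule member_le_sum[OF mem_nn(4)]) (use V g_le F.fin in auto)
  then show "0 \<le> g v" using deficit by simp
  have "g w - g t \<le> (\<Sum>y\<in>nn t. g y - g t)"
    by (rule member_le_sum[OF mem_nn(5)]) (use V g_le F.fin in auto)
  then show "g w \<le> 0" using deficit by simp
qed

lemma card_nb_ge: "x \<in> V \<Longrightarrow> 2 \<le> card (nb x)" "x \<in> V \<Longrightarrow> 2 \<le> card (nn x)"
  using two_connected_card_nbs[OF tc(1) F.fin] two_connected_card_nbs[OF tc(2) F.fin] card_V by auto

lemma card_nb_nn_ge: "x \<in> V \<Longrightarrow> 31 \<le> card (nb x) + card (nn x)"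
  using card_nbs_compl[OF F.fin, of x A] card32 by simp

lemma extreme_signs: "0 \<le> f v" "0 \<le> - f w" "0 \<le> g s" "0 \<le> - g t"
  using signs f_le(1)[OF mem(4)] f_le(2)[OF mem(3)] g_le(1)[OF mem(1)] g_le(2)[OF mem(2)] by linarith+

lemma one_le_sum: "1 \<le> f v - f w + (g s - g t)"
proof (rule osc_sum)
  show "\<bar>f x\<bar> \<le> f v - f w" "\<bar>g x\<bar> \<le> g s - g t" if "x \<in> V" for x
    using f_le[OF that] g_le[OF that] extreme_signs by linarith+
  show "f x - f y \<le> f v - f w" "g x - g y \<le> g s - g t" if "x \<in> V" "y \<in> V" for x y
    using f_le[OF that(1)] f_le[OF that(2)] g_le[OF that(1)] g_le[OF that(2)] by linarith+
qed

section \<open>Estimates for the values on the path\<close>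

abbreviation B where "B \<equiv> (\<Sum>x\<in>nb v. ppart (- g x))"

text \<open>\<open>cut_two\<close> in the complement bounds the mass that \<open>g\<close> has on
  nonneighbours of \<open>w\<close> and \<open>v\<close>. As each part of \<open>g\<close> has total
  mass 1, the neighbours carry at least 1 together, and each neighbour of \<open>w\<close> carries
  at most \<open>g s\<close>.\<close>

lemma cut_path: "1 \<le> card (nb w) * g s + B"
proof -
  have "(\<Sum>x\<in>nn w. ppart (g x)) + (\<Sum>x\<in>nn v. ppart (- g x)) \<le> 1"
    using G.cut_two[of w v] mem signs dist card_nb_ge(2)[OF mem(1)] by auto
  moreover have "(\<Sum>x\<in>nb w. ppart (g x)) + (\<Sum>x\<in>nn w. ppart (g x)) = 1"
    using F.sum_nb_nn_eq[OF mem(2), of "\<lambda>x. ppart (g x)"] G.sum_ppart signs by simp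
  moreover have "B + (\<Sum>x\<in>nn v. ppart (- g x)) = 1"
    using F.sum_nb_nn_eq[OF mem(1), of "\<lambda>x. ppart (- g x)"] G.sum_ppart signs by simp
  moreover have "(\<Sum>x\<in>nb w. ppart (g x)) \<le> of_nat (card (nb w)) * g s"
  proof (rule sum_bounded_above)
    fix x assume "x \<in> nb w"
    then have "g x \<le> g s" using g_le by (simp add: nbs_def)
    then show "ppart (g x) \<le> g s" using signs g_le[OF mem(1)] by simp
  qed
  ultimately show ?thesis by simp
qed

text \<open>In the second bound \<open>y\<close> contributes nothing and saves one term. This saving
  is what makes \<open>m0\<close> smaller than \<open>X\<close> in the applications of
  \<open>chain\<close>.\<close>

lemma sum_neg_le:
  fixes c :: real
  assumes "S \<subseteq> V" "\<And>x. x \<in> V \<Longrightarrow> - c \<le> h x" "0 \<le> c"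
  shows "(\<Sum>x\<in>S. ppart (- h x)) \<le> card S * c"
    and "y \<in> S \<Longrightarrow> 0 \<le> h y \<Longrightarrow> (\<Sum>x\<in>S. ppart (- h x)) \<le> (card S - 1) * c"
proof -
  have fS: "finite S" using assms F.fin finite_subset by blast
  have le: "ppart (- h x) \<le> c" if "x \<in> S" for x using assms(1) assms(2)[of x] assms(3) that by auto
  show "(\<Sum>x\<in>S. ppart (- h x)) \<le> card S * c"
    using sum_bounded_above[of S, OF le] by simp
  assume y: "y \<in> S" "0 \<le> h y"
  have "(\<Sum>x\<in>S. ppart (- h x)) = (\<Sum>x\<in>S - {y}. ppart (- h x))"
    using y fS by (simp add: sum.remove[OF fS y(1)])
  also have "\<dots> \<le> card (S - {y}) * c"
    by (rule sum_bounded_above) (use le in blast)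
  finally show "(\<Sum>x\<in>S. ppart (- h x)) \<le> (card S - 1) * c" using y by simp
qed

lemma g_sub: "- (- g t) \<le> g x" if "x \<in> V" for x
  using g_le that by simp

lemma B_le: "B \<le> card (nb v) * - g t"
  using sum_neg_le(1)[where S = "nb v" and h = g, OF nbs_subset g_sub extreme_signs(4)] .

lemma B_le': "x \<in> nb v \<Longrightarrow> 0 \<le> g x \<Longrightarrow> B \<le> (card (nb v) - 1) * - g t"
  using sum_neg_le(2)[where S = "nb v" and h = g, OF nbs_subset g_sub extreme_signs(4)] .

text \<open>\<open>chain\<close> in the complement, with centre \<open>v\<close> and maximum
  \<open>s\<close>. The nonneighbours of \<open>v\<close> there are its neighbours here, so the mass
  in question is \<open>B\<close>.\<close>

lemma chain_v:
  fixes K :: nat and X m0 d :: real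
  assumes "B \<le> X" "\<And>x. x \<in> nb v \<Longrightarrow> 0 < g x \<Longrightarrow> B \<le> m0"
    and K: "K * (K - 1) \<le> 2 * card (nn v)" "2 \<le> K" and d: "d \<le> card (nn v)" "0 < d"
  shows "g s \<le> m0 \<or> g s \<le> X / d * (real K * (real K - 1) / 2)
    \<or> K * g s - X / d * ((real K ^ 3 - real K) / 6) \<le> 1"
proof -
  have "0 \<le> B" by (rule sum_nonneg) simp
  then have Xd: "X / card (nn v) \<le> X / d" using d assms(1) by (intro divide_left_mono) auto
  have "real K \<le> real K ^ 3" using K(2) by (intro self_le_power) auto
  then have "X / card (nn v) * ((real K ^ 3 - real K) / 6) \<le> X / d * ((real K ^ 3 - real K) / 6)"
    using Xd by (intro mult_right_mono) auto
  moreover have "X / card (nn v) * (real K * (real K - 1) / 2) \<le> X / d * (real K * (real K - 1) / 2)"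
    using Xd K(2) by (intro mult_right_mono) auto
  moreover have "g s \<le> m0 \<or> g s \<le> X / card (nn v) * (real K * (real K - 1) / 2)
    \<or> K * g s - X / card (nn v) * ((real K ^ 3 - real K) / 6) \<le> 1"
    using G.chain[OF tc(2) mem(1) signs(3) mem(3) dist(2)[symmetric] g_le(1), of X m0 K] assms mem_nb(1)
    by auto
  ultimately show ?thesis by linarith
qed

text \<open>\<open>chain\<close> in the graph itself, with centre \<open>t\<close> and maximum
  \<open>v\<close>; the negative mass is estimated by the minimum \<open>f w\<close>.\<close>

lemma chain_t:
  fixes K :: nat and X m0 d :: real
  assumes "card (nn t) * - f w \<le> X" "(card (nn t) - 1) * - f w \<le> m0"
    and K: "K * (K - 1) \<le> 2 * card (nb t)" "2 \<le> K" and d: "d \<le> card (nb t)" "0 < d"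
  shows "f v \<le> m0 \<or> f v \<le> X / d * (real K * (real K - 1) / 2)
    \<or> K * f v - X / d * ((real K ^ 3 - real K) / 6) \<le> 1"
proof -
  have f_sub: "- (- f w) \<le> f x" if "x \<in> V" for x using f_le that by simp
  have Q: "(\<Sum>x\<in>nn t. ppart (- f x)) \<le> X"
    using sum_neg_le(1)[where S = "nn t" and h = f, OF nbs_subset f_sub extreme_signs(2)] assms(1) by simp
  have Q': "(\<Sum>x\<in>nn t. ppart (- f x)) \<le> m0" if "x \<in> nn t" "0 < f x" for x
    using sum_neg_le(2)[where S = "nn t" and h = f, OF nbs_subset f_sub extreme_signs(2) that(1)] that(2) assms(2) by simp
  have "0 \<le> (\<Sum>x\<in>nn t. ppart (- f x))" by (rule sum_nonneg) simp
  then have Xd: "X / card (nb t) \<le> X / d" using d Q by (intro divide_left_mono) auto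
  have "real K \<le> real K ^ 3" using K(2) by (intro self_le_power) auto
  then have "X / card (nb t) * ((real K ^ 3 - real K) / 6) \<le> X / d * ((real K ^ 3 - real K) / 6)"
    using Xd by (intro mult_right_mono) auto
  moreover have "X / card (nb t) * (real K * (real K - 1) / 2) \<le> X / d * (real K * (real K - 1) / 2)"
    using Xd K(2) by (intro mult_right_mono) auto
  moreover have "f v \<le> m0 \<or> f v \<le> X / card (nb t) * (real K * (real K - 1) / 2)
    \<or> K * f v - X / card (nb t) * ((real K ^ 3 - real K) / 6) \<le> 1"
    using F.chain[OF tc(1) mem(4) signs(1) mem(1) dist(3) f_le(1), of X m0 K] Q Q' K mem_nn(5)
    by auto
  ultimately show ?thesis by linarith
qed

lemma sup_le:
  assumes "x \<in> V" "real k \<le> card (nb x)" "0 < k" shows "\<bar>f x\<bar> \<le> 1 / k"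
proof -
  have "real k * \<bar>f x\<bar> \<le> card (nb x) * \<bar>f x\<bar>" using assms by (intro mult_right_mono) auto
  then show ?thesis using F.deg_bound[OF assms(1)] assms(3) by (simp add: field_simps)
qed

lemma sup_le':
  assumes "x \<in> V" "real k \<le> card (nn x)" "0 < k" shows "\<bar>g x\<bar> \<le> 1 / k"
proof -
  have "real k * \<bar>g x\<bar> \<le> card (nn x) * \<bar>g x\<bar>" using assms by (intro mult_right_mono) auto
  then show ?thesis using G.deg_bound[OF assms(1)] assms(3) by (simp add: field_simps)
qed

lemma card_le:
  assumes "x \<in> V" "1 < real (Suc k) * \<bar>f x\<bar>" shows "card (nb x) \<le> k"
proof (rule ccontr)
  assume "\<not> ?thesis"
  then have "real (Suc k) * \<bar>f x\<bar> \<le> card (nb x) * \<bar>f x\<bar>"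
    by (intro mult_right_mono) auto
  then show False using F.deg_bound[OF assms(1)] assms(2) by linarith
qed

lemma card_le':
  assumes "x \<in> V" "1 < real (Suc k) * \<bar>g x\<bar>" shows "card (nn x) \<le> k"
proof (rule ccontr)
  assume "\<not> ?thesis"
  then have "real (Suc k) * \<bar>g x\<bar> \<le> card (nn x) * \<bar>g x\<bar>"
    by (intro mult_right_mono) auto
  then show False using G.deg_bound[OF assms(1)] assms(2) by linarith
qed

section \<open>The case in which \<open>f v\<close> is the largest of the four absolute
  values\<close>

context
  assumes f_max: "- f w \<le> f v" "g s \<le> f v" "- g t \<le> f v"
begin

lemma f_v_ge: "1 / 4 \<le> f v" using one_le_sum f_max by linarith

lemma card_nb_v: "card (nb v) \<le> 4"
  by (rule card_le) (use f_v_ge mem in auto)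

text \<open>A small \<open>- g t\<close> makes \<open>B\<close> small. Then \<open>chain_v\<close>
  limits \<open>g s\<close>, so \<open>cut_path\<close> forces many neighbours on \<open>w\<close>
  and a small \<open>- f w\<close>, and the four values fall short of 1. The threshold 1/11 limits
  \<open>card (nn t)\<close> to 10 and exceeds 2/27, which is what the end of the argument
  needs.\<close>

lemma g_t_gt: "1 / 11 < - g t"
proof (rule ccontr)
  assume "\<not> ?thesis"
  then have gt: "- g t \<le> 1 / 11" by simp
  define D where "D = card (nb v)"
  define E where "E = card (nb w)"
  have D: "D = 2 \<or> D = 3 \<or> D = 4"
    using card_nb_v card_nb_ge(1)[OF mem(1)] unfolding D_def by linarith
  have DV: "31 \<le> D + card (nn v)" using card_nb_nn_ge[OF mem(1)] by (simp add: D_def)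
  have gs: "0 \<le> g s" using signs g_le[OF mem(1)] by simp
  have B: "B \<le> D / 11"
  proof -
    have "D * - g t \<le> D * (1 / 11)" using gt by (intro mult_left_mono) auto
    then show ?thesis using B_le by (simp add: D_def)
  qed
  have B': "B \<le> (D - 1) / 11" if "x \<in> nb v" "0 < g x" for x
  proof -
    have "real (D - 1) * - g t \<le> real (D - 1) * (1 / 11)" using gt by (intro mult_left_mono) auto
    then show ?thesis using B_le'[OF that(1)] that(2) D by (simp add: D_def)
  qed
  have fv: "f v \<le> 1 / D" using sup_le[OF mem(1), of D] D by (auto simp: D_def)
  have cut: "1 \<le> E * g s + B" using cut_path by (simp add: E_def)
  from D consider "D = 2" | "D = 3" | "D = 4" by blast
  then show False
  proof cases
    case 1
    \<comment> \<open>29 is 31 - 2. The last alternative is the weakest one: \<open>7 * g s\<close>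
      is at most 1 + 56 * (2/11) / 29.\<close>
    have "g s \<le> 1 / 11 \<or> g s \<le> (2 / 11) / 29 * (real 7 * (real 7 - 1) / 2)
      \<or> real 7 * g s - (2 / 11) / 29 * ((real 7 ^ 3 - real 7) / 6) \<le> 1"
      by (rule chain_v) (use B B' 1 DV in auto)
    then have gs2: "g s \<le> 0.19303" by auto
    have "5 \<le> E"
    proof (rule ccontr)
      assume "\<not> 5 \<le> E"
      then have "real E * g s \<le> 4 * g s" using gs by (intro mult_right_mono) auto
      then show False using cut B 1 gs2 by simp
    qed
    then have "\<bar>f w\<bar> \<le> 1 / 5" using sup_le[OF mem(2), of 5] by (simp add: E_def)
    then show False using one_le_sum fv 1 gs2 gt by simp
  next
    case 2
    have "g s \<le> 2 / 11 \<or> g s \<le> (3 / 11) / 28 * (real 6 * (real 6 - 1) / 2)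
      \<or> real 6 * g s - (3 / 11) / 28 * ((real 6 ^ 3 - real 6) / 6) \<le> 1"
      by (rule chain_v) (use B B' 2 DV in auto)
    then have gs2: "g s \<le> 0.2235" by auto
    have "8 / 11 \<le> E * g s" using cut B 2 by simp
    \<comment> \<open>Comparing \<open>E * g s \<ge> 8 / 11\<close> with
      \<open>E * \<bar>f w\<bar> \<le> 1\<close> eliminates the unknown degree
      \<open>E\<close>.\<close>
    then have "- f w * (8 / 11) \<le> - f w * (E * g s)"
      using extreme_signs(2) by (intro mult_left_mono) auto
    also have "\<dots> = (E * \<bar>f w\<bar>) * g s" using extreme_signs(2) by simp
    also have "\<dots> \<le> 1 * g s"
      using F.deg_bound[OF mem(2)] gs by (intro mult_right_mono) (auto simp: E_def)
    finally show False using one_le_sum fv 2 gs2 gt by simp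
  next
    case 3
    then show False using fv f_max one_le_sum gt by simp
  qed
qed

lemma card_nn_t: "card (nn t) \<le> 10"
  by (rule card_le') (use g_t_gt mem in auto)

lemma f_t_le: "f t \<le> 1 / 21"
  using sup_le[OF mem(4), of 21] card_nn_t card_nb_nn_ge[OF mem(4)] by auto

text \<open>Of the total deficit \<open>f v\<close> at \<open>v\<close> the neighbour
  \<open>t\<close> takes \<open>f v - f t\<close>, so only \<open>f t\<close>, at most 1/21, is left
  for the other neighbours. Their values exceed 1/4 - 1/21 > 1/5, their degree is at most 4, and
  they have at least 27 nonneighbours.\<close>

lemma U_props:
  assumes "u \<in> nb v" "u \<noteq> t"
  shows "1 / 5 < f u" "f v - f u \<le> f t" "card (nb u) \<le> 4" "\<bar>g u\<bar> \<le> 1 / 27" "u \<in> V" "u \<noteq> v" "u \<noteq> w"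
    "u \<noteq> s"
proof -
  show u: "u \<in> V" "u \<noteq> v" using assms by (auto simp: nbs_def)
  show "u \<noteq> w" "u \<noteq> s" using assms path by (auto simp: nbs_def)
  have "(\<Sum>y\<in>{t, u}. f v - f y) \<le> (\<Sum>y\<in>nb v. f v - f y)"
    by (rule sum_mono2) (use assms mem_nb F.fin f_le in \<open>auto simp: nbs_def\<close>)
  then show le: "f v - f u \<le> f t" using assms(2) deficit(1) by simp
  then show gt: "1 / 5 < f u" using f_t_le f_v_ge by simp
  then show c: "card (nb u) \<le> 4" using u by (intro card_le) auto
  show "\<bar>g u\<bar> \<le> 1 / 27" using sup_le'[OF u(1), of 27] c card_nb_nn_ge[OF u(1)] by auto
qed

text \<open>The neighbours \<open>s\<close> and \<open>t\<close> have small or negative values and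
  contribute nearly \<open>2 * f u\<close> to the equation at \<open>u\<close>. At most two further
  neighbours exceed \<open>f u\<close>, each by at most \<open>e\<close>, and cannot bring the sum
  back to \<open>f u\<close>.\<close>

lemma not_both:
  assumes "u \<in> nb v" "u \<noteq> t" "A u s" "A u t"
  shows False
proof -
  note u = U_props[OF assms(1,2)]
  define e where "e = f v - f u"
  have e: "0 \<le> e" "e \<le> f t" using f_le u by (auto simp: e_def)
  have st: "{s, t} \<subseteq> nb u" using mem assms u by (auto simp: nbs_def)
  have "(\<Sum>y\<in>nb u - {s, t}. - e) \<le> (\<Sum>y\<in>nb u - {s, t}. f u - f y)"
    by (rule sum_mono) (use f_le in \<open>auto simp: e_def nbs_def\<close>)
  then have "- (card (nb u - {s, t}) * e) \<le> (\<Sum>y\<in>nb u - {s, t}. f u - f y)" by simp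
  moreover have "(\<Sum>y\<in>nb u. f u - f y) = (\<Sum>y\<in>nb u - {s, t}. f u - f y) + (\<Sum>y\<in>{s, t}. f u - f y)"
    using st F.fin by (intro sum.subset_diff) auto
  moreover have "(\<Sum>y\<in>{s, t}. f u - f y) = 2 * f u - f s - f t" using dist by simp
  moreover have "card (nb u - {s, t}) * e \<le> 2 * e"
  proof (rule mult_right_mono)
    have "card (nb u - {s, t}) = card (nb u) - 2" using st dist by (simp add: card_Diff_subset)
    then show "real (card (nb u - {s, t})) \<le> 2" using u(3) by simp
  qed (rule e)
  ultimately have "f u \<le> 2 * e + f t + f s" using F.eig[OF u(5)] by linarith
  then show False using e signs f_t_le u(1) by linarith
qed

lemma f_v_le: "f v \<le> 1 / 2" "\<bar>g t\<bar> \<le> 1 / 2"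
  using sup_le[OF mem(1), of 2] sup_le'[OF mem(4), of 2] card_nb_ge[OF mem(1)] card_nb_ge[OF mem(4)] by auto

lemma adj_s:
  assumes u: "u \<in> nb v" "u \<noteq> t" shows "A u s"
proof (rule ccontr)
  assume "\<not> A u s"
  note uu = U_props[OF u]
  have "\<not> A s u" using \<open>\<not> A u s\<close> F.sym[of s u, THEN iffD1] by blast
  then have uT: "u \<in> nn s" using uu(5,8) by (simp add: nbs_def)
  \<comment> \<open>In the complement \<open>v\<close> and \<open>u\<close> are both neighbours of
    \<open>s\<close> and share its deficit \<open>g s\<close>. As \<open>g v\<close> and
    \<open>g u\<close> are at most 1/27, \<open>g s\<close> becomes tiny.\<close>
  have "(\<Sum>y\<in>{v, u}. g s - g y) \<le> (\<Sum>y\<in>nn s. g s - g y)"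
    by (rule sum_mono2) (use uT mem_nn F.fin g_le in \<open>auto simp: nbs_def\<close>)
  then have gsu: "g s - g u \<le> g v" using uu(6) deficit(3) by simp
  have gv: "\<bar>g v\<bar> \<le> 1 / 27"
    using sup_le'[OF mem(1), of 27] card_nb_v card_nb_nn_ge[OF mem(1)] by auto
  have gs: "g s \<le> 2 / 27" "0 \<le> g s" using gsu gv uu(4) signs g_le[OF mem(1)] by auto
  have gu: "0 \<le> g u" using gsu g_le[OF mem(1)] by simp
  have B: "B \<le> - g t + 2 / 27"
  proof -
    have "B = (\<Sum>x\<in>nb v - {t, u}. ppart (- g x)) + (\<Sum>x\<in>{t, u}. ppart (- g x))"
      using u mem_nb F.fin by (intro sum.subset_diff) auto
    also have "(\<Sum>x\<in>{t, u}. ppart (- g x)) = - g t" using u(2) gu extreme_signs(4) by simp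
    also have "(\<Sum>x\<in>nb v - {t, u}. ppart (- g x)) \<le> of_nat (card (nb v - {t, u})) * (1 / 27)"
    proof (rule sum_bounded_above)
      fix x assume "x \<in> nb v - {t, u}"
      then show "ppart (- g x) \<le> 1 / 27" using U_props(4)[of x] by auto
    qed
    also have "card (nb v - {t, u}) = card (nb v) - 2"
      using u mem_nb by (simp add: card_Diff_subset)
    finally show ?thesis using card_nb_v by auto
  qed
  have w_bound: "real k < card (nb w)" if "real k * (2 / 27) < 1 - B" for k
  proof (rule ccontr)
    assume "\<not> ?thesis"
    then have "card (nb w) * g s \<le> real k * (2 / 27)" using gs by (intro mult_mono) auto
    then show False using cut_path that by linarith
  qed
  have "real 5 < card (nb w)" by (rule w_bound) (use B f_v_le in auto)
  then have fw: "\<bar>f w\<bar> \<le> 1 / 6" using sup_le[OF mem(2), of 6] by simp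
  \<comment> \<open>7/27 is what 1/2, 1/6 and 2/27 leave of 1; four times this exceeds 1, which
    bounds \<open>card (nn t)\<close> by 3.\<close>
  have gt: "7 / 27 \<le> - g t" using one_le_sum f_v_le fw gs by simp
  have E': "card (nn t) \<le> 3" by (rule card_le') (use gt mem in auto)
  have fv: "7 / 27 \<le> f v" using one_le_sum f_v_le fw gs by simp
  from E' card_nb_ge(2)[OF mem(4)] consider "card (nn t) = 2" | "card (nn t) = 3" by linarith
  then show False
  proof cases
    case 1
    \<comment> \<open>The weakest alternative gives about 0.246 here and about 0.254 in the other
      case, both below 7/27.\<close>
    have "f v \<le> 1 / 6 \<or> f v \<le> (1 / 3) / 29 * (real 5 * (real 5 - 1) / 2)
      \<or> real 5 * f v - (1 / 3) / 29 * ((real 5 ^ 3 - real 5) / 6) \<le> 1"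
      by (rule chain_t) (use fw 1 card_nb_nn_ge[OF mem(4)] in auto)
    then show False using fv by auto
  next
    case 2
    then have "\<bar>g t\<bar> \<le> 1 / 3" using sup_le'[OF mem(4), of 3] by simp
    then have "real 7 < card (nb w)" by (intro w_bound) (use B in auto)
    then have fw: "\<bar>f w\<bar> \<le> 1 / 8" using sup_le[OF mem(2), of 8] by simp
    have "f v \<le> 1 / 4 \<or> f v \<le> (3 / 8) / 28 * (real 5 * (real 5 - 1) / 2)
      \<or> real 5 * f v - (3 / 8) / 28 * ((real 5 ^ 3 - real 5) / 6) \<le> 1"
      by (rule chain_t) (use fw 2 card_nb_nn_ge[OF mem(4)] in auto)
    then show False using fv by auto
  qed
qed

lemma no_path_f_max: False
proof -
  have "\<exists>u\<in>nb v. u \<noteq> t"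
  proof (rule ccontr)
    assume "\<not> ?thesis"
    then have "nb v \<subseteq> {t}" by blast
    then have "card (nb v) \<le> card {t}" by (rule card_mono[rotated]) simp
    then show False using card_nb_ge(1)[OF mem(1)] by simp
  qed
  then obtain u where u: "u \<in> nb v" "u \<noteq> t" by blast
  have nnt: "x \<in> nn t" if "x \<in> nb v" "x \<noteq> t" for x
  proof -
    have "\<not> A t x" using not_both[OF that adj_s[OF that]] F.sym[of t x, THEN iffD1] by blast
    then show ?thesis using U_props(5)[OF that] that(2) by (simp add: nbs_def)
  qed
  note uu = U_props[OF u]
  have g_u: "- (1 / 27) \<le> g u" using uu(4) by linarith
  have single: "nb v = {t, u}"
  proof (rule ccontr)
    assume "nb v \<noteq> {t, u}"
    then obtain x where x: "x \<in> nb v" "x \<noteq> t" "x \<noteq> u" using u mem_nb by blast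
    note xx = U_props[OF x(1,2)]
    \<comment> \<open>By \<open>adj_s\<close> and \<open>not_both\<close> the neighbours of
      \<open>v\<close> other than \<open>t\<close> are nonneighbours of \<open>t\<close>. Two of
      them besides \<open>w\<close> are too many for the deficit at \<open>t\<close>: they would
      give \<open>- g t\<close> at most 2/27, which is less than 1/11.\<close>
    have "(\<Sum>y\<in>{w, u, x}. g y - g t) \<le> (\<Sum>y\<in>nn t. g y - g t)"
      by (rule sum_mono2) (use nnt[OF u] nnt[OF x(1,2)] mem_nn F.fin g_le in \<open>auto simp: nbs_def\<close>)
    then have "(g u - g t) + (g x - g t) \<le> - g w" using uu(7) xx(7) x(3) deficit(4) by simp
    moreover have "g t \<le> g w" using g_le mem by simp
    moreover have "- (1 / 27) \<le> g x" using xx(4) by linarith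
    ultimately show False using g_u g_t_gt by linarith
  qed
  have D: "card (nb v) = 2" using u by (simp add: single)
  have "(\<Sum>y\<in>{w, u}. g y - g t) \<le> (\<Sum>y\<in>nn t. g y - g t)"
    by (rule sum_mono2) (use nnt[OF u] mem_nn F.fin g_le in \<open>auto simp: nbs_def\<close>)
  then have gw: "g u - g t \<le> - g w" using uu(7) deficit(4) by simp
  have "card (nn w) \<le> 18" by (rule card_le') (use gw g_u g_t_gt mem in auto)
  then have fw: "\<bar>f w\<bar> \<le> 1 / 13" using sup_le[OF mem(2), of 13] card_nb_nn_ge[OF mem(2)] by auto
  \<comment> \<open>\<open>0 \<le> f t\<close> makes the sum of \<open>f\<close> over the
    nonneighbours of \<open>t\<close> nonpositive, so the negative mass there has to balance
    \<open>f u\<close>; \<open>u\<close> itself saves one term.\<close>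
  have fu: "f u \<le> (card (nn t) - 1) * - f w"
  proof -
    have f_sub: "- (- f w) \<le> f x" if "x \<in> V" for x using f_le that by simp
    have "f u \<le> ppart (f u)" by simp
    also have "\<dots> \<le> (\<Sum>x\<in>nn t. ppart (f x))"
      by (rule member_le_sum[OF nnt[OF u]]) (use F.fin in auto)
    also have "\<dots> \<le> (\<Sum>x\<in>nn t. ppart (- f x))"
    proof -
      have "0 \<le> card (nb t) * f t" using signs by simp
      then show ?thesis using F.deg_eq_nn[OF mem(4)] F.sum_split[of "nn t"] by linarith
    qed
    also have "\<dots> \<le> (card (nn t) - 1) * - f w"
      using sum_neg_le(2)[where S = "nn t" and h = f, OF nbs_subset f_sub extreme_signs(2) nnt[OF u]] uu(1) by simp
    finally show ?thesis .
  qed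
  \<comment> \<open>A larger \<open>- g t\<close> would cap \<open>card (nn t)\<close> at 5 and
    \<open>- f w\<close> at 1/24, hence \<open>f u\<close> at 1/6, against
    \<open>1 / 5 < f u\<close>.\<close>
  have gt: "- g t \<le> 1 / 6"
  proof (rule ccontr)
    assume "\<not> ?thesis"
    then have gt: "1 / 6 < - g t" by simp
    have t5: "card (nn t) \<le> 5" by (rule card_le') (use gt mem in auto)
    have "card (nn w) \<le> 7" by (rule card_le') (use gw g_u gt mem in auto)
    then have "\<bar>f w\<bar> \<le> 1 / 24" using sup_le[OF mem(2), of 24] card_nb_nn_ge[OF mem(2)] by auto
    then have "real (card (nn t) - 1) * - f w \<le> 4 * (1 / 24)"
      using t5 extreme_signs(2) by (intro mult_mono) auto
    then show False using fu uu(1) by linarith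
  qed
  have B: "B = - g t + ppart (- g u)" using u extreme_signs(4) by (simp add: single)
  \<comment> \<open>11/54 is 1/6 + 1/27. The first alternative is sound because only
    \<open>u\<close> can be a neighbour of \<open>v\<close> with positive \<open>g\<close>, and then
    \<open>B\<close> equals \<open>- g t\<close>.\<close>
  have "g s \<le> 1 / 6 \<or> g s \<le> (11 / 54) / 29 * (real 7 * (real 7 - 1) / 2)
      \<or> real 7 * g s - (11 / 54) / 29 * ((real 7 ^ 3 - real 7) / 6) \<le> 1"
  proof (rule chain_v)
    show "B \<le> 11 / 54" unfolding B using gt g_u by simp
    show "B \<le> 1 / 6" if "x \<in> nb v" "0 < g x" for x
      using that single gt extreme_signs(4) unfolding B by auto
  qed (use D card_nb_nn_ge[OF mem(1)] in auto)
  then have "g s \<le> 0.1991" by auto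
  then show False using one_le_sum f_v_le fw gt by simp
qed

end

end

text \<open>Successive rotations put \<open>g s\<close>, \<open>- f w\<close> and
  \<open>- g t\<close> in the place of \<open>f v\<close>, so the largest of the four can be brought
  there.\<close>

lemma no_extremal_path: "\<not> extremal_path V A f g v w s t"
proof
  assume c0: "extremal_path V A f g v w s t"
  note c1 = extremal_path.rotate[OF c0]
  note c2 = extremal_path.rotate[OF c1]
  note c3 = extremal_path.rotate[OF c2]
  consider "- f w \<le> f v" "g s \<le> f v" "- g t \<le> f v"
    | "- g t \<le> g s" "- f w \<le> g s" "f v \<le> g s"
    | "f v \<le> - f w" "- g t \<le> - f w" "g s \<le> - f w"
    | "g s \<le> - g t" "f v \<le> - g t" "- f w \<le> - g t"
    by linarith
  then show False
    using extremal_path.no_path_f_max[OF c0] extremal_path.no_path_f_max[OF c1]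
      extremal_path.no_path_f_max[OF c2] extremal_path.no_path_f_max[OF c3]
    by cases auto
qed

section \<open>Spectral gaps\<close>

definition dirichlet :: "'a set \<Rightarrow> ('a \<Rightarrow> 'a \<Rightarrow> bool) \<Rightarrow> ('a \<Rightarrow> real) \<Rightarrow> real" where
  "dirichlet V A h = (\<Sum>x\<in>V. \<Sum>y\<in>nbs V A x. (h x - h y)\<^sup>2) / 2"

text \<open>Discrete Green identity. Its symmetry in \<open>h\<close> and \<open>k\<close> yields
  orthogonality of eigenfunctions, and \<open>k = 1\<close> yields sum zero.\<close>

lemma sum_mult_laplacian:
  fixes h k :: "'a \<Rightarrow> real"
  assumes "finite V" "\<And>x y. A x y \<longleftrightarrow> A y x"
  shows "(\<Sum>x\<in>V. k x * (\<Sum>y\<in>nbs V A x. h x - h y))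
    = (\<Sum>x\<in>V. \<Sum>y\<in>nbs V A x. (k x - k y) * (h x - h y)) / 2"
proof -
  let ?S = "\<Sum>x\<in>V. \<Sum>y\<in>nbs V A x. k x * (h x - h y)"
  have "?S = (\<Sum>x\<in>V. \<Sum>y\<in>nbs V A x. k y * (h y - h x))"
    using assms by (rule sum_nbs_swap)
  then have "2 * ?S = ?S + (\<Sum>x\<in>V. \<Sum>y\<in>nbs V A x. k y * (h y - h x))" by simp
  also have "\<dots> = (\<Sum>x\<in>V. \<Sum>y\<in>nbs V A x. (k x - k y) * (h x - h y))"
    unfolding sum.distrib[symmetric] by (intro sum.cong) (simp_all add: algebra_simps)
  finally have "?S = (\<Sum>x\<in>V. \<Sum>y\<in>nbs V A x. (k x - k y) * (h x - h y)) / 2" by simp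
  then show ?thesis by (simp only: sum_distrib_left)
qed

lemma dirichlet_eq:
  assumes "finite V" "\<And>x y. A x y \<longleftrightarrow> A y x"
  shows "(\<Sum>x\<in>V. h x * (\<Sum>y\<in>nbs V A x. h x - h y)) = dirichlet V A h"
  unfolding dirichlet_def sum_mult_laplacian[OF assms] by (simp add: power2_eq_square)

text \<open>The two Laplacians add up to that of the complete graph, which acts as
  \<open>card V\<close> on functions of sum zero.\<close>

lemma dirichlet_compl:
  fixes h :: "'a \<Rightarrow> real"
  assumes "finite V" and "(\<Sum>x\<in>V. h x) = 0"
  shows "dirichlet V A h + dirichlet V (\<lambda>x y. \<not> A x y) h = card V * (\<Sum>x\<in>V. (h x)\<^sup>2)"
proof -
  have "2 * (dirichlet V A h + dirichlet V (\<lambda>x y. \<not> A x y) h) = (\<Sum>x\<in>V. \<Sum>y\<in>V. (h x - h y)\<^sup>2)"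
    unfolding dirichlet_def using assms(1)
    by (simp add: sum.distrib[symmetric] sum_nbs_compl)
  also have "\<dots> = (\<Sum>x\<in>V. card V * (h x)\<^sup>2 + (\<Sum>y\<in>V. (h y)\<^sup>2) - 2 * h x * (\<Sum>y\<in>V. h y))"
    by (simp add: power2_diff sum.distrib sum_subtractf sum_distrib_left)
  also have "\<dots> = 2 * (card V * (\<Sum>x\<in>V. (h x)\<^sup>2))"
    using assms(2) by (simp add: sum.distrib sum_distrib_left)
  finally show ?thesis by simp
qed

text \<open>Only edges at \<open>z\<close> contribute energy; each is met once in the row of
  \<open>z\<close> and once in the row of its other end, which cancels the factor 1/2.\<close>

lemma dirichlet_star:
  assumes fin: "finite V" and sym: "\<And>x y. A x y \<longleftrightarrow> A y x" and z: "z \<in> V"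
    and const: "\<And>x y. x \<in> V - {z} \<Longrightarrow> y \<in> nbs V A x - {z} \<Longrightarrow> h x = h y"
  shows "dirichlet V A h = (\<Sum>y\<in>nbs V A z. (h z - h y)\<^sup>2)"
proof -
  have "(\<Sum>y\<in>nbs V A x. (h x - h y)\<^sup>2) = (if x \<in> nbs V A z then (h z - h x)\<^sup>2 else 0)"
    if x: "x \<in> V - {z}" for x
  proof -
    have "(\<Sum>y\<in>nbs V A x. (h x - h y)\<^sup>2) = (\<Sum>y\<in>nbs V A x \<inter> {z}. (h x - h y)\<^sup>2)"
      using fin const[OF x] by (intro sum.mono_neutral_right) auto
    also have "nbs V A x \<inter> {z} = (if x \<in> nbs V A z then {z} else {})"
      using x z sym by (auto simp: nbs_def)
    finally show ?thesis by (simp add: power2_commute)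
  qed
  then have "(\<Sum>x\<in>V - {z}. \<Sum>y\<in>nbs V A x. (h x - h y)\<^sup>2)
      = (\<Sum>x\<in>V - {z}. if x \<in> nbs V A z then (h z - h x)\<^sup>2 else 0)" by simp
  also have "\<dots> = (\<Sum>x\<in>(V - {z}) \<inter> nbs V A z. (h z - h x)\<^sup>2)"
    using fin by (simp add: sum.inter_restrict)
  also have "(V - {z}) \<inter> nbs V A z = nbs V A z" by (auto simp: nbs_def)
  finally show ?thesis unfolding dirichlet_def using sum.remove[OF fin z, of "\<lambda>x. \<Sum>y\<in>nbs V A x. (h x - h y)\<^sup>2"]
    by simp
qed

text \<open>If \<open>z\<close> separates \<open>S\<close> from \<open>R\<close>, the test function that is constant on \<open>S\<close>, constant on \<open>R\<close> and zero at
  \<open>z\<close> forces \<open>z\<close> to be adjacent to all other vertices, and then \<open>card V\<close> is an eigenvalue.\<close>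

lemma two_connected_of_gap:
  assumes fin: "finite V" and sym: "\<And>x y. A x y \<longleftrightarrow> A y x"
    and gap: "\<And>h. (\<Sum>x\<in>V. h x) = 0 \<Longrightarrow> (\<Sum>x\<in>V. (h x)\<^sup>2) \<le> dirichlet V A h"
      "\<And>h. (\<Sum>x\<in>V. h x) = 0 \<Longrightarrow> dirichlet V A h \<le> (real (card V) - 1) * (\<Sum>x\<in>V. (h x)\<^sup>2)"
  shows "two_connected V A"
  unfolding two_connected_def
proof (intro ballI allI impI, rule ccontr)
  fix z S
  assume z: "z \<in> V" and S: "S \<noteq> {}" "S \<subset> V - {z}"
    and no: "\<not> (\<exists>x\<in>S. \<exists>y\<in>V - {z} - S. A x y)"
  define R where "R = V - {z} - S"
  have fS: "finite S" "finite R" using S fin finite_subset unfolding R_def by blast+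
  have R: "R \<noteq> {}" using S by (auto simp: R_def)
  have V: "V = insert z (S \<union> R)" "z \<notin> S \<union> R" "S \<inter> R = {}" using S z by (auto simp: R_def)
  have c: "0 < card S" "0 < card R" using S R fS by (simp_all add: card_gt_0_iff)
  define h where "h x = (if x \<in> S then 1 / card S else if x \<in> R then - 1 / card R else 0)" for x
  have sum_V: "(\<Sum>x\<in>V. k x) = k z + ((\<Sum>x\<in>S. k x) + (\<Sum>x\<in>R. k x))" for k :: "'a \<Rightarrow> real"
  proof -
    have "(\<Sum>x\<in>V. k x) = k z + (\<Sum>x\<in>S \<union> R. k x)" using V fS by simp
    then show ?thesis using V(3) fS by (simp add: sum.union_disjoint)
  qed
  have hz: "h z = 0" using V by (simp add: h_def)
  have hS: "h x = 1 / card S" if "x \<in> S" for x using that by (simp add: h_def)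
  have hR: "h x = - 1 / card R" if "x \<in> R" for x using that V(3) by (auto simp: h_def)
  have "(\<Sum>x\<in>V. h x) = 0"
    unfolding sum_V using c by (simp add: hz hS hR)
  then have le: "(\<Sum>x\<in>V. (h x)\<^sup>2) \<le> dirichlet V A h" by (rule gap)
  have star: "dirichlet V A h = (\<Sum>y\<in>nbs V A z. (h z - h y)\<^sup>2)"
  proof (rule dirichlet_star[OF fin sym z])
    fix x y assume x: "x \<in> V - {z}" and y: "y \<in> nbs V A x - {z}"
    then have "A x y" "A y x" "y \<in> V" "y \<noteq> z" using sym[of x y] by (auto simp: nbs_def)
    then have "x \<in> S \<longleftrightarrow> y \<in> S" using no x unfolding R_def by blast
    then show "h x = h y" using x \<open>y \<in> V\<close> \<open>y \<noteq> z\<close> by (simp add: h_def R_def)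
  qed
  \<comment> \<open>\<open>h z = 0\<close>, so the energy is the sum of squares over the neighbours
    of \<open>z\<close>. As \<open>h\<close> vanishes nowhere else, a missing neighbour would make
    it smaller than the full sum of squares.\<close>
  have all: "nbs V A z = V - {z}"
  proof (rule ccontr)
    assume "nbs V A z \<noteq> V - {z}"
    then obtain x where x: "x \<in> V - {z}" "x \<notin> nbs V A z" by (auto simp: nbs_def)
    have "(h x)\<^sup>2 > 0" using x c by (auto simp: h_def R_def)
    moreover have "(\<Sum>x\<in>insert x (nbs V A z). (h x)\<^sup>2) \<le> (\<Sum>x\<in>V. (h x)\<^sup>2)"
      using x fin by (intro sum_mono2) (auto simp: nbs_def)
    moreover have "(\<Sum>x\<in>insert x (nbs V A z). (h x)\<^sup>2) = (h x)\<^sup>2 + (\<Sum>y\<in>nbs V A z. (h y)\<^sup>2)"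
      using x(2) fin by simp
    moreover have "dirichlet V A h = (\<Sum>y\<in>nbs V A z. (h y)\<^sup>2)" using star hz by simp
    ultimately show False using le by linarith
  qed
  \<comment> \<open>For a vertex \<open>z\<close> adjacent to all others this is the eigenfunction
    for \<open>card V\<close>, which violates the upper gap.\<close>
  define k where "k x = (if x = z then real (card V) - 1 else - 1)" for x
  have cV: "card V = card S + card R + 1" using V fS by (simp add: card_Un_disjoint)
  have kz: "k z = real (card V) - 1" "\<And>x. x \<in> S \<Longrightarrow> k x = -1" "\<And>x. x \<in> R \<Longrightarrow> k x = -1"
    using V by (auto simp: k_def)
  have "(\<Sum>x\<in>V. k x) = 0" unfolding sum_V using cV by (simp add: kz)
  then have "dirichlet V A k \<le> (real (card V) - 1) * (\<Sum>x\<in>V. (k x)\<^sup>2)" by (rule gap)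
  moreover have "(\<Sum>x\<in>V. (k x)\<^sup>2) = (real (card V) - 1) * card V"
    unfolding sum_V using cV by (simp add: kz power2_eq_square algebra_simps)
  moreover have "dirichlet V A k = (\<Sum>y\<in>nbs V A z. (k z - k y)\<^sup>2)"
    by (rule dirichlet_star[OF fin sym z]) (auto simp: k_def)
  moreover have "(\<Sum>y\<in>nbs V A z. (k z - k y)\<^sup>2) = (\<Sum>y\<in>nbs V A z. (real (card V))\<^sup>2)"
    by (rule sum.cong) (auto simp: k_def nbs_def)
  moreover have "real (card (nbs V A z)) = real (card V) - 1" unfolding all using z fin cV by simp
  ultimately have "(real (card V) - 1) * (card V * real (card V)) \<le> (real (card V) - 1) * ((real (card V) - 1) * card V)"
    by (simp add: power2_eq_square)
  then have "card V * real (card V) \<le> (real (card V) - 1) * card V"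
    using cV c by (simp add: mult_le_cancel_left_pos)
  then show False using cV by (simp add: mult_le_cancel_right)
qed

lemma fiedler_normalize:
  fixes f :: "'a \<Rightarrow> real"
  assumes "finite V" "\<And>x y. A x y \<longleftrightarrow> A y x"
    and eig: "\<And>x. x \<in> V \<Longrightarrow> (\<Sum>y\<in>nbs V A x. f x - f y) = f x"
    and "x0 \<in> V" "f x0 \<noteq> 0"
  shows "\<exists>c. fiedler V A (\<lambda>x. c * f x)"
proof -
  define s where "s = (\<Sum>x\<in>V. \<bar>f x\<bar>)"
  have "\<bar>f x0\<bar> \<le> s" unfolding s_def using assms by (intro member_le_sum) auto
  then have s: "0 < s" using assms by simp
  have "fiedler V A (\<lambda>x. 2 / s * f x)"
  proof
    show "(\<Sum>y\<in>nbs V A x. 2 / s * f x - 2 / s * f y) = 2 / s * f x" if "x \<in> V" for x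
    proof -
      have "(\<Sum>y\<in>nbs V A x. 2 / s * f x - 2 / s * f y) = 2 / s * (\<Sum>y\<in>nbs V A x. f x - f y)"
        unfolding sum_distrib_left right_diff_distrib ..
      then show ?thesis using eig[OF that] by simp
    qed
    have "(\<Sum>x\<in>V. f x) = (\<Sum>x\<in>V. 1 * (\<Sum>y\<in>nbs V A x. f x - f y))" using eig by simp
    also have "\<dots> = 0" unfolding sum_mult_laplacian[OF assms(1,2)] by simp
    finally show "(\<Sum>x\<in>V. 2 / s * f x) = 0" by (simp only: sum_distrib_left[symmetric] mult_zero_right)
    have "(\<Sum>x\<in>V. \<bar>2 / s * f x\<bar>) = 2 / s * s"
      using s by (simp only: s_def sum_distrib_left abs_mult) (simp add: s_def)
    then show "(\<Sum>x\<in>V. \<bar>2 / s * f x\<bar>) = 2" using s by simp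
  qed (fact assms(1), rule assms(2))
  then show ?thesis by blast
qed

theorem no_gap_eigenfunctions:
  fixes f g :: "'a \<Rightarrow> real"
  assumes fin: "finite V" and sym: "\<And>x y. A x y \<longleftrightarrow> A y x" and card: "32 \<le> card V"
    and gap: "\<And>h. (\<Sum>x\<in>V. h x) = 0 \<Longrightarrow> (\<Sum>x\<in>V. (h x)\<^sup>2) \<le> dirichlet V A h"
      "\<And>h. (\<Sum>x\<in>V. h x) = 0 \<Longrightarrow> dirichlet V A h \<le> (real (card V) - 1) * (\<Sum>x\<in>V. (h x)\<^sup>2)"
    and f: "\<And>x. x \<in> V \<Longrightarrow> (\<Sum>y\<in>nbs V A x. f x - f y) = f x" "x1 \<in> V" "f x1 \<noteq> 0"
    and g: "\<And>x. x \<in> V \<Longrightarrow> (\<Sum>y\<in>nbs V A x. g x - g y) = (real (card V) - 1) * g x"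
      "x2 \<in> V" "g x2 \<noteq> 0"
  shows False
proof -
  define B where "B x y \<longleftrightarrow> \<not> A x y" for x y
  have symB: "B x y \<longleftrightarrow> B y x" for x y using sym[of x y] by (simp add: B_def)
  have Bdef: "B = (\<lambda>x y. \<not> A x y)" by (auto simp: B_def fun_eq_iff)
  have "(real (card V) - 1) * (\<Sum>x\<in>V. g x) = (\<Sum>x\<in>V. 1 * (\<Sum>y\<in>nbs V A x. g x - g y))"
    using g(1) by (simp add: sum_distrib_left)
  also have "\<dots> = 0" unfolding sum_mult_laplacian[OF fin sym] by simp
  finally have g0: "(\<Sum>x\<in>V. g x) = 0" using card by simp
  \<comment> \<open>Moving the Laplacian from \<open>f\<close> to \<open>g\<close> shows that the
    inner product equals \<open>card V - 1\<close> times itself.\<close>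
  have orth: "(\<Sum>x\<in>V. f x * g x) = 0"
  proof -
    have "(\<Sum>x\<in>V. f x * g x) = (\<Sum>x\<in>V. g x * (\<Sum>y\<in>nbs V A x. f x - f y))"
      using f(1) by (simp add: mult.commute)
    also have "\<dots> = (\<Sum>x\<in>V. f x * (\<Sum>y\<in>nbs V A x. g x - g y))"
      unfolding sum_mult_laplacian[OF fin sym] by (simp add: mult.commute)
    also have "\<dots> = (real (card V) - 1) * (\<Sum>x\<in>V. f x * g x)"
      using g(1) by (simp add: sum_distrib_left mult_ac)
    finally have "(real (card V) - 2) * (\<Sum>x\<in>V. f x * g x) = 0" by (simp add: algebra_simps)
    then show ?thesis using card by simp
  qed
  have gB: "(\<Sum>y\<in>nbs V B x. g x - g y) = g x" if "x \<in> V" for x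
  proof -
    have "(\<Sum>y\<in>nbs V A x. g x - g y) + (\<Sum>y\<in>nbs V B x. g x - g y) = (\<Sum>y\<in>V. g x - g y)"
      unfolding Bdef using sum_nbs_compl[OF fin that, of "\<lambda>y. g x - g y" A] by simp
    then show ?thesis using g(1)[OF that] g0 by (simp add: sum_subtractf algebra_simps)
  qed
  obtain c1 where F: "fiedler V A (\<lambda>x. c1 * f x)" using fiedler_normalize[OF fin sym f] by blast
  obtain c2 where G: "fiedler V B (\<lambda>x. c2 * g x)" using fiedler_normalize[OF fin symB gB g(2,3)] by blast
  have tA: "two_connected V A" using two_connected_of_gap[OF fin sym gap] .
  have tB: "two_connected V B"
  proof (rule two_connected_of_gap[OF fin symB])
    fix h :: "'a \<Rightarrow> real" assume h: "(\<Sum>x\<in>V. h x) = 0"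
    note E = dirichlet_compl[OF fin h, of A, folded Bdef] gap[OF h]
    then show "(\<Sum>x\<in>V. (h x)\<^sup>2) \<le> dirichlet V B h"
      "dirichlet V B h \<le> (real (card V) - 1) * (\<Sum>x\<in>V. (h x)\<^sup>2)"
      by (simp_all add: algebra_simps)
  qed
  define p where "p x = c1 * f x" for x
  define q where "q x = c2 * g x" for x
  have F': "fiedler V A p" and G': "fiedler V B q" using F G by (simp_all add: p_def[abs_def] q_def[abs_def])
  obtain v w where v: "v \<in> V" "w \<in> V" "\<forall>x\<in>V. p w \<le> p x \<and> p x \<le> p v" "v \<noteq> w" "\<not> A v w"
      "nbs V A v \<inter> nbs V A w = {}"
    using fiedler.extreme_pair[OF F' tA] by blast
  obtain s t where s: "s \<in> V" "t \<in> V" "\<forall>x\<in>V. q t \<le> q x \<and> q x \<le> q s" "s \<noteq> t" "\<not> B s t"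
      "nbs V B s \<inter> nbs V B t = {}"
    using fiedler.extreme_pair[OF G' tB] by blast
  have vw: "\<not> (A v x \<and> A w x)" if "x \<in> V" "x \<noteq> v" "x \<noteq> w" for x
    using v(6) that by (auto simp: nbs_def)
  have st: "A s x \<or> A t x" if "x \<in> V" "x \<noteq> s" "x \<noteq> t" for x
    using s(6) that by (auto simp: nbs_def B_def)
  have Ast: "A s t" using s(5) by (simp add: B_def)
  have ex: "extremal_path V A p q' v w s' t'"
    if "fiedler V B q'" "\<And>x. x \<in> V \<Longrightarrow> q' x \<le> q' s'" "\<And>x. x \<in> V \<Longrightarrow> q' t' \<le> q' x"
      "(\<Sum>x\<in>V. p x * q' x) = 0"
      "s' \<in> V" "t' \<in> V" "v \<noteq> s'" "v \<noteq> t'" "w \<noteq> s'" "w \<noteq> t'" "s' \<noteq> t'" "A v t'" "A w s'" "A s' t'"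
      "\<not> A v s'" "\<not> A w t'" for q' s' t'
    using that F' tA tB v card unfolding Bdef
    by (simp add: extremal_path_def extremal_path_axioms_def fiedler_pair_def fiedler_pair_axioms_def)
  have orth': "(\<Sum>x\<in>V. p x * q x) = 0"
  proof -
    have "(\<Sum>x\<in>V. p x * q x) = c1 * c2 * (\<Sum>x\<in>V. f x * g x)"
      unfolding sum_distrib_left by (simp add: p_def q_def mult_ac)
    then show ?thesis using orth by simp
  qed
  have dist: "v \<noteq> s" "v \<noteq> t" "w \<noteq> s" "w \<noteq> t"
    using v s vw[of s] vw[of t] st[of v] st[of w] Ast sym[of v w] sym[of s t] sym[of v t] sym[of w t]
      sym[of v s] sym[of w s] by blast+
  \<comment> \<open>\<open>v\<close> and \<open>w\<close> have no common neighbour, while every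
    further vertex is adjacent to \<open>s\<close> or \<open>t\<close>. So \<open>v\<close> and
    \<open>w\<close> are each adjacent to exactly one of \<open>s\<close> and \<open>t\<close>, and
    not to the same one.\<close>
  have a: "A v s \<or> A v t" "A w s \<or> A w t" "\<not> (A v s \<and> A w s)" "\<not> (A v t \<and> A w t)"
    using st[OF v(1) dist(1,2)] st[OF v(2) dist(3,4)] vw[of s] vw[of t] s(1,2) dist
      sym[of v t] sym[of w t] sym[of v s] sym[of w s] by auto
  show False
  proof (cases "A v t")
    case True
    then have "extremal_path V A p q v w s t"
      using G' s orth' dist a Ast by (intro ex) auto
    then show False using no_extremal_path[of V A p q v w s t] by simp
  next
    case False
    \<comment> \<open>The path runs the other way; negating \<open>q\<close> exchanges its maximum
      and its minimum.\<close>
    have "A t s" using Ast sym[of s t] by simp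
    then have "extremal_path V A p (\<lambda>x. - q x) v w t s"
      using fiedler.fiedler_uminus[OF G'] s orth' dist a False
      by (intro ex) (auto simp: sum_negf)
    then show False using no_extremal_path[of V A p "\<lambda>x. - q x" v w t s] by simp
  qed
qed

section \<open>Diagonalization of symmetric matrices\<close>

lemma monic_eq_prod_proots:
  fixes p :: "real poly"
  assumes "monic p" "size (proots p) = degree p"
  shows "p = (\<Prod>x\<in>#proots p. [:- x, 1:])"
  using assms
proof (induction "degree p" arbitrary: p)
  case 0
  then have "proots p = {#}" by simp
  moreover have "p = 1" using 0 by (metis monic_degree_0)
  ultimately show ?case by simp
next
  case (Suc d)
  then have "proots p \<noteq> {#}" by force
  then obtain a where a: "a \<in># proots p" by blast
  have p0: "p \<noteq> 0" using Suc.prems by auto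
  then have "poly p a = 0" using a by simp
  then obtain q where q: "p = [:- a, 1:] * q" by (metis dvdE poly_eq_0_iff_dvd)
  then have q0: "q \<noteq> 0" using p0 by auto
  have deg: "degree p = Suc (degree q)" unfolding q using q0 by (subst degree_mult_eq) auto
  have pr: "proots p = {#a#} + proots q" unfolding q using q0 by (subst proots_mult) auto
  have "monic q" using Suc.prems(1) unfolding q by (simp add: lead_coeff_mult del: mult_pCons_left)
  moreover have "size (proots q) = degree q" using Suc.prems(2) deg pr by simp
  ultimately have "q = (\<Prod>x\<in>#proots q. [:- x, 1:])" using Suc.hyps deg by simp
  then show ?case unfolding pr using q by simp
qed

text \<open>Orthogonal deflation: a unit eigenvector for the first root is completed to an
  orthonormal basis. Symmetry clears the first row along with the first column, and the remaining
  block is again symmetric. Assuming a factorization over the reals avoids complex eigenvalues and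
  fixes the order on the diagonal.\<close>

lemma symmetric_mat_diagonalization:
  fixes A :: "real mat"
  assumes "A \<in> carrier_mat n n" "A\<^sup>T = A" "char_poly A = (\<Prod>e\<leftarrow>es. [:- e, 1:])"
  shows "\<exists>P \<in> carrier_mat n n. P\<^sup>T * P = 1\<^sub>m n \<and> P\<^sup>T * A * P = mat n n (\<lambda>(i, j). if i = j then es ! i else 0)"
  using assms
proof (induction es arbitrary: n A)
  case Nil
  then have "n = 0" using degree_monic_char_poly[of A n] by simp
  then show ?case using Nil by (intro bexI[of _ "1\<^sub>m 0"]) auto
next
  case (Cons e es n A)
  let ?n1 = "n - 1"
  have A: "A \<in> carrier_mat n n" by (rule Cons.prems)
  have cp: "char_poly A = [: -e, 1 :] * (\<Prod>e \<leftarrow> es. [:- e, 1:])" using Cons.prems by simp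
  have mon: "monic (\<Prod>e\<leftarrow> es. [:- e, 1:])" by (rule monic_prod_list) auto
  have "degree (char_poly A) = Suc (degree (\<Prod>e\<leftarrow> es. [:- e, 1:]))"
    unfolding cp using mon by (subst degree_mult_eq) auto
  then have n: "n \<noteq> 0" using degree_monic_char_poly[OF A] by simp
  have "eigenvalue A e" unfolding eigenvalue_root_char_poly[OF A] cp by simp
  then obtain v where ev: "eigenvector A v e" by (auto simp: eigenvalue_def)
  then have v: "v \<in> carrier_vec n" "v \<noteq> 0\<^sub>v n" "A *\<^sub>v v = e \<cdot>\<^sub>v v"
    using A by (auto simp: eigenvector_def)
  interpret cof_vec_space n "TYPE(real)" .
  define b where "b = basis_completion v"
  from basis_completion[OF v(1,2), folded b_def]
  have dist_b: "distinct b" and indep: "\<not> lin_dep (set b)" and b: "set b \<subseteq> carrier_vec n"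
    and hdb: "hd b = v" and len_b: "length b = n" by auto
  from hdb len_b n obtain vs where bv: "b = v # vs" by (cases b) auto
  define ws where "ws = gram_schmidt n b"
  from gram_schmidt_result[OF b dist_b indep refl, folded ws_def]
  have ws: "set ws \<subseteq> carrier_vec n" "corthogonal ws" "length ws = n"
    by (auto simp: len_b)
  have hdws: "hd ws = v" using gram_schmidt_hd[OF v(1), of vs, folded bv] by (simp add: ws_def)
  define u where "u i = (1 / sqrt (ws ! i \<bullet> ws ! i)) \<cdot>\<^sub>v ws ! i" for i
  have wsc: "ws ! i \<in> carrier_vec n" if "i < n" for i using ws that by auto
  have uc: "u i \<in> carrier_vec n" if "i < n" for i using wsc[OF that] by (simp add: u_def)
  have wo: "(ws ! i \<bullet> ws ! j = 0) \<longleftrightarrow> i \<noteq> j" if "i < n" "j < n" for i j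
    using corthogonalD[OF ws(2), of i j] that ws(3) by simp
  have uu: "u i \<bullet> u j = (if i = j then 1 else 0)" if ij: "i < n" "j < n" for i j
  proof -
    have "u i \<bullet> u j = (1 / sqrt (ws ! i \<bullet> ws ! i)) * (1 / sqrt (ws ! j \<bullet> ws ! j)) * (ws ! i \<bullet> ws ! j)"
      unfolding u_def using wsc[OF ij(1)] wsc[OF ij(2)]
      by (simp add: smult_scalar_prod_distrib[of _ n] scalar_prod_smult_distrib[of _ n])
    moreover have "0 < ws ! i \<bullet> ws ! i"
      using wo[OF ij(1) ij(1)] conjugate_square_ge_0_vec[of "ws ! i"] by simp
    ultimately show ?thesis using wo[OF ij] by (auto simp: real_sqrt_mult_self)
  qed
  define W where "W = mat_of_cols n (map u [0..<n])"
  have W: "W \<in> carrier_mat n n" using mat_of_cols_carrier(1)[of n "map u [0..<n]"] by (simp add: W_def)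
  have colW: "col W i = u i" if "i < n" for i using that uc by (simp add: W_def)
  have WW: "W\<^sup>T * W = 1\<^sub>m n"
    by (rule eq_matI) (use W uu in \<open>auto simp: colW\<close>)
  define A' where "A' = W\<^sup>T * A * W"
  have A': "A' \<in> carrier_mat n n" using W A by (simp add: A'_def)
  have "W * W\<^sup>T = 1\<^sub>m n" using mat_mult_left_right_inverse[of "W\<^sup>T" n W] W WW by simp
  then have sim: "similar_mat A' A"
    unfolding similar_mat_def using W A A' WW
    by (intro exI[of _ "W\<^sup>T"] exI[of _ W] similar_mat_witI[of _ _ n]) (auto simp: A'_def)
  have symA': "A'\<^sup>T = A'"
  proof -
    have "A'\<^sup>T = W\<^sup>T * (A\<^sup>T * W\<^sup>T\<^sup>T)"
      unfolding A'_def using W A by (subst transpose_mult[of _ n n _ n]; simp)+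
    then show ?thesis using Cons.prems(2) W A by (simp add: A'_def assoc_mult_mat[of _ n n _ n _ n])
  qed
  have u0: "u 0 = (1 / sqrt (v \<bullet> v)) \<cdot>\<^sub>v v"
  proof -
    have "ws ! 0 = v" using hdws ws(3) n by (cases ws) auto
    then show ?thesis by (simp add: u_def)
  qed
  have Au0: "A *\<^sub>v u 0 = e \<cdot>\<^sub>v u 0"
    unfolding u0 using v A by (simp add: mult_mat_vec smult_smult_assoc mult.commute)
  have A'0: "A' $$ (i, 0) = (if i = 0 then e else 0)" if i: "i < n" for i
  proof -
    have "A' $$ (i, 0) = (W\<^sup>T * (A * W)) $$ (i, 0)"
      unfolding A'_def using W A by (simp add: assoc_mult_mat[of _ n n _ n _ n])
    also have "\<dots> = row W\<^sup>T i \<bullet> col (A * W) 0"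
      using W A i n by (intro index_mult_mat(1)) auto
    also have "row W\<^sup>T i = u i" using W i by (simp add: colW)
    also have "col (A * W) 0 = A *\<^sub>v u 0"
      using W A n by (subst col_mult2[of _ n n _ n]) (auto simp: colW)
    also have "u i \<bullet> (A *\<^sub>v u 0) = e * (u i \<bullet> u 0)" unfolding Au0 using uc[OF i] uc[of 0] n by (simp add: scalar_prod_smult_distrib[of _ n])
    finally show ?thesis using uu[OF i, of 0] n by simp
  qed
  have A'0': "A' $$ (0, i) = (if i = 0 then e else 0)" if i: "i < n" for i
    using A'0[OF i] symA' A' i n by (metis index_transpose_mat(1) carrier_matD not_gr_zero)
  obtain A1 A2 A0 A3 where split: "split_block A' 1 1 = (A1, A2, A0, A3)"
    by (cases "split_block A' 1 1") auto
  from A' n have "dim_row A' = 1 + ?n1" "dim_col A' = 1 + ?n1" by auto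
  from split_block[OF split this] have A1: "A1 \<in> carrier_mat 1 1" and A2: "A2 \<in> carrier_mat 1 ?n1"
    and A0: "A0 \<in> carrier_mat ?n1 1" and A3: "A3 \<in> carrier_mat ?n1 ?n1"
    and A'block: "A' = four_block_mat A1 A2 A0 A3" by auto
  note sp = split[unfolded split_block_def Let_def]
  have A1id: "A1 = mat 1 1 (\<lambda>_. e)" using sp A'0[of 0] n by auto
  have A0id: "A0 = 0\<^sub>m ?n1 1" using sp A'0 A' by auto
  have A2id: "A2 = 0\<^sub>m 1 ?n1" using sp A'0' A' by auto
  have symA3: "A3\<^sup>T = A3"
  proof (rule eq_matI)
    fix i j assume "i < dim_row A3" "j < dim_col A3"
    then have ij: "Suc i < n" "Suc j < n" using A3 by auto
    have "A' $$ (Suc j, Suc i) = A' $$ (Suc i, Suc j)"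
      using symA' A' ij by (metis index_transpose_mat(1) carrier_matD)
    then show "A3\<^sup>T $$ (i, j) = A3 $$ (i, j)" using sp A' ij by auto
  qed (use A3 in auto)
  have "[: -e, 1 :] * (\<Prod>e \<leftarrow> es. [:- e, 1:]) = char_poly A1 * char_poly A3"
    using char_poly_similar[OF sim] cp char_poly_four_block_zeros_col[OF A1 A2 A3]
    unfolding A'block A0id by simp
  also have "char_poly A1 = [: -e, 1 :]"
    by (simp add: A1id char_poly_defs det_def sign_def)
  finally have "char_poly A3 = (\<Prod>e \<leftarrow> es. [:- e, 1:])"
    by (metis mult_cancel_left pCons_eq_0_iff zero_neq_one)
  from Cons.IH[OF A3 symA3 this] obtain P' where P': "P' \<in> carrier_mat ?n1 ?n1"
    "P'\<^sup>T * P' = 1\<^sub>m ?n1"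
    "P'\<^sup>T * A3 * P' = mat ?n1 ?n1 (\<lambda>(i, j). if i = j then es ! i else 0)" by blast
  define B where "B = four_block_mat (1\<^sub>m 1) (0\<^sub>m 1 ?n1) (0\<^sub>m ?n1 1) P'"
  have B: "B \<in> carrier_mat n n"
  proof -
    have "B \<in> carrier_mat (1 + ?n1) (1 + ?n1)" unfolding B_def using P' by (intro four_block_carrier_mat) auto
    then show ?thesis using n by simp
  qed
  have BT: "B\<^sup>T = four_block_mat (1\<^sub>m 1) (0\<^sub>m 1 ?n1) (0\<^sub>m ?n1 1) P'\<^sup>T"
    unfolding B_def using P' by (subst transpose_four_block_mat[of _ 1 1 _ ?n1 _ ?n1]) auto
  have BB: "B\<^sup>T * B = 1\<^sub>m n"
  proof -
    have "B\<^sup>T * B = four_block_mat (1\<^sub>m 1) (0\<^sub>m 1 ?n1) (0\<^sub>m ?n1 1) (1\<^sub>m ?n1)"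
      unfolding BT unfolding B_def using P'
      by (subst mult_four_block_mat[of _ 1 1 _ ?n1 _ ?n1 _ _ 1 _ ?n1]) auto
    also have "\<dots> = 1\<^sub>m n" using n by (intro eq_matI) auto
    finally show ?thesis .
  qed
  have BA: "B\<^sup>T * A' * B = mat n n (\<lambda>(i, j). if i = j then (e # es) ! i else 0)"
  proof -
    have "B\<^sup>T * A' = four_block_mat A1 (0\<^sub>m 1 ?n1) (0\<^sub>m ?n1 1) (P'\<^sup>T * A3)"
      unfolding BT A'block A0id A2id using P' A1 A3
      by (subst mult_four_block_mat[of _ 1 1 _ ?n1 _ ?n1 _ _ 1 _ ?n1]) auto
    then have "B\<^sup>T * A' * B = four_block_mat A1 (0\<^sub>m 1 ?n1) (0\<^sub>m ?n1 1) (P'\<^sup>T * A3 * P')"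
      unfolding B_def using P' A1 A3
      by (simp add: mult_four_block_mat[of _ 1 1 _ ?n1 _ ?n1 _ _ 1 _ ?n1])
    also have "\<dots> = mat n n (\<lambda>(i, j). if i = j then (e # es) ! i else 0)"
      unfolding P'(3) A1id using n by (intro eq_matI) (auto simp: nth_Cons')
    finally show ?thesis .
  qed
  have WB: "(W * B)\<^sup>T = B\<^sup>T * W\<^sup>T" using W B by (rule transpose_mult)
  show ?case
  proof (intro bexI[of _ "W * B"] conjI)
    show "(W * B)\<^sup>T * (W * B) = 1\<^sub>m n"
    proof -
      have "(W * B)\<^sup>T * (W * B) = B\<^sup>T * ((W\<^sup>T * W) * B)"
        unfolding WB using W B by (simp add: assoc_mult_mat[of _ n n _ n _ n])
      then show ?thesis using WW BB B by simp
    qed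
    have "(W * B)\<^sup>T * A * (W * B) = B\<^sup>T * A' * B"
      unfolding WB A'_def using W B A by (simp add: assoc_mult_mat[of _ n n _ n _ n])
    then show "(W * B)\<^sup>T * A * (W * B) = mat n n (\<lambda>(i, j). if i = j then (e # es) ! i else 0)"
      using BA by simp
  qed (use W B in simp)
qed

lemma symmetric_mat_spectral:
  fixes A :: "real mat"
  assumes A: "A \<in> carrier_mat n n" and sym: "A\<^sup>T = A" and cp: "char_poly A = (\<Prod>e\<leftarrow>es. [:- e, 1:])"
  obtains u where "\<And>i. i < n \<Longrightarrow> u i \<in> carrier_vec n" "\<And>i. i < n \<Longrightarrow> A *\<^sub>v u i = es ! i \<cdot>\<^sub>v u i"
    "\<And>i. i < n \<Longrightarrow> u i \<bullet> u i = 1"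
    "\<And>x y. x \<in> carrier_vec n \<Longrightarrow> y \<in> carrier_vec n \<Longrightarrow> x \<bullet> y = (\<Sum>i<n. (u i \<bullet> x) * (u i \<bullet> y))"
    "\<And>i x. i < n \<Longrightarrow> x \<in> carrier_vec n \<Longrightarrow> u i \<bullet> (A *\<^sub>v x) = es ! i * (u i \<bullet> x)"
proof -
  obtain P where P: "P \<in> carrier_mat n n" "P\<^sup>T * P = 1\<^sub>m n"
    "P\<^sup>T * A * P = mat n n (\<lambda>(i, j). if i = j then es ! i else 0)"
    using symmetric_mat_diagonalization[OF A sym cp] by blast
  define D where "D = P\<^sup>T * A * P"
  have D: "D \<in> carrier_mat n n" using P A by (simp add: D_def)
  have PP: "P * P\<^sup>T = 1\<^sub>m n" using mat_mult_left_right_inverse[of "P\<^sup>T" n P] P by simp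
  have AP: "A * P = P * D"
  proof -
    have "P * D = (P * P\<^sup>T) * (A * P)"
      unfolding D_def using P(1) A by (simp add: assoc_mult_mat[of _ n n _ n _ n])
    then show ?thesis using PP P(1) A by simp
  qed
  have PTA: "P\<^sup>T * A = D * P\<^sup>T"
  proof -
    have "D * P\<^sup>T = (P\<^sup>T * A) * (P * P\<^sup>T)"
      unfolding D_def using P(1) A by (simp add: assoc_mult_mat[of _ n n _ n _ n])
    then show ?thesis using PP P(1) A by simp
  qed
  have c: "col P i \<in> carrier_vec n" for i using P(1) by auto
  have PTx: "(P\<^sup>T *\<^sub>v x) $ i = col P i \<bullet> x" if "i < n" for i x using that P(1) by simp
  have row_D: "row D i = es ! i \<cdot>\<^sub>v unit_vec n i" if "i < n" for i
    using that by (intro eq_vecI) (auto simp: D_def P(3))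
  show ?thesis
  proof (rule that[of "col P"])
    show "col P i \<in> carrier_vec n" for i by (rule c)
    show "col P i \<bullet> col P i = 1" if "i < n" for i
    proof -
      have "col P i \<bullet> col P i = (P\<^sup>T * P) $$ (i, i)" using that P(1) by simp
      then show ?thesis using P(2) that by simp
    qed
    show "x \<bullet> y = (\<Sum>i<n. (col P i \<bullet> x) * (col P i \<bullet> y))"
      if x: "x \<in> carrier_vec n" and y: "y \<in> carrier_vec n" for x y
    proof -
      have "x \<bullet> y = x \<bullet> (P *\<^sub>v (P\<^sup>T *\<^sub>v y))"
        using PP P(1) y by (simp add: assoc_mult_mat_vec[symmetric, of _ n n _ n])
      also have "\<dots> = (P\<^sup>T *\<^sub>v x) \<bullet> (P\<^sup>T *\<^sub>v y)"
        using P(1) x y by (intro transpose_vec_mult_scalar[symmetric]) auto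
      also have "\<dots> = (\<Sum>i<n. (P\<^sup>T *\<^sub>v x) $ i * (P\<^sup>T *\<^sub>v y) $ i)"
        using P(1) by (simp add: scalar_prod_def lessThan_atLeast0)
      finally show ?thesis using PTx by simp
    qed
    show ip: "col P i \<bullet> (A *\<^sub>v x) = es ! i * (col P i \<bullet> x)" if i: "i < n" and x: "x \<in> carrier_vec n" for i x
    proof -
      have "col P i \<bullet> (A *\<^sub>v x) = ((P\<^sup>T * A) *\<^sub>v x) $ i"
        using PTx[OF i, of "A *\<^sub>v x"] P(1) A x by (simp add: assoc_mult_mat_vec[of _ n n _ n])
      also have "\<dots> = row D i \<bullet> (P\<^sup>T *\<^sub>v x)"
        unfolding PTA using P(1) D x i by (simp add: assoc_mult_mat_vec[of _ n n _ n])
      also have "\<dots> = es ! i * (col P i \<bullet> x)"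
        unfolding row_D[OF i] using P(1) x i
        by (simp add: smult_scalar_prod_distrib[of _ n] scalar_prod_left_unit[of _ n] PTx[OF i, symmetric] del: index_mult_mat_vec)
      finally show ?thesis .
    qed
    show "A *\<^sub>v col P i = es ! i \<cdot>\<^sub>v col P i" if i: "i < n" for i
    proof -
      have "A *\<^sub>v col P i = col (P * D) i" unfolding AP[symmetric] using col_mult2[OF A P(1) i] by simp
      also have "\<dots> = P *\<^sub>v (es ! i \<cdot>\<^sub>v unit_vec n i)"
      proof -
        have "col D i = es ! i \<cdot>\<^sub>v unit_vec n i"
          using i by (intro eq_vecI) (auto simp: D_def P(3))
        then show ?thesis using col_mult2[OF P(1) D i] by simp
      qed
      also have "\<dots> = es ! i \<cdot>\<^sub>v col P i"
        using P(1) i by (intro eq_vecI) (auto simp: mult_mat_vec[of _ n n])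
      finally show ?thesis .
    qed
  qed
qed

section \<open>Laplacian spectra\<close>

lemma laplacian_mult:
  assumes G: "pair_graph G" and x: "x \<in> pverts G"
  shows "(\<Sum>y\<in>pverts G. laplacian G x y * h y) = (\<Sum>y\<in>nbs (pverts G) (\<lambda>x y. (x, y) \<in> parcs G) x. h x - h y)"
proof -
  interpret pair_graph G by (rule G)
  let ?N = "nbs (pverts G) (\<lambda>x y. (x, y) \<in> parcs G) x"
  have N: "finite ?N" "?N \<subseteq> pverts G - {x}" by (auto simp: nbs_def)
  have "b \<in> ?N" if "(x, b) \<in> parcs G" for b
    using no_loops'[OF that] in_arcsD2[OF that] that by (simp add: nbs_def)
  then have "out_arcs (with_proj G) x = Pair x ` ?N"
    by (auto simp: nbs_def out_arcs_def)
  then have "out_degree (with_proj G) x = card (Pair x ` ?N)" by (simp add: out_degree_def)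
  also have "\<dots> = card ?N" by (rule card_image) (simp add: inj_on_def)
  finally have deg: "laplacian G x x = card ?N" by (simp add: laplacian_def)
  have "(\<Sum>y\<in>pverts G. laplacian G x y * h y)
      = laplacian G x x * h x + (\<Sum>y\<in>pverts G - {x}. laplacian G x y * h y)"
    using x by (intro sum.remove) auto
  also have "(\<Sum>y\<in>pverts G - {x}. laplacian G x y * h y) = (\<Sum>y\<in>?N. - h y)"
    using N by (intro sum.mono_neutral_cong_right) (auto simp: nbs_def laplacian_def)
  finally show ?thesis by (simp add: deg sum_negf sum_subtractf)
qed

text \<open>\<open>size\<close> makes the characteristic polynomial split over the reals. The simple
  eigenvalue 0 belongs to the constants, so a function of sum zero has components only at nonzero
  natural numbers, which lie between 1 and \<open>b\<close>.\<close>

theorem laplacian_spectrum_gap: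
  fixes G :: "'a pair_pre_digraph" and M :: "nat multiset" and b :: nat and h :: "'a \<Rightarrow> real"
  defines "A \<equiv> \<lambda>x y. (x, y) \<in> parcs G"
  assumes G: "pair_graph G" and spec: "laplacian_spectrum G = image_mset real M"
    and size: "size M = card (pverts G)" and zero: "count M 0 = 1" and le: "\<forall>k\<in>#M. k \<le> b"
  shows "(\<Sum>x\<in>pverts G. h x) = 0 \<Longrightarrow> (\<Sum>x\<in>pverts G. (h x)\<^sup>2) \<le> dirichlet (pverts G) A h"
    and "(\<Sum>x\<in>pverts G. h x) = 0 \<Longrightarrow> dirichlet (pverts G) A h \<le> b * (\<Sum>x\<in>pverts G. (h x)\<^sup>2)"
    and "k \<in># M \<Longrightarrow> \<exists>f :: 'a \<Rightarrow> real. (\<forall>x\<in>pverts G. (\<Sum>y\<in>nbs (pverts G) A x. f x - f y) = k * f x) \<and> (\<exists>x\<in>pverts G. f x \<noteq> 0)"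
proof -
  interpret pair_graph G by (rule G)
  let ?V = "pverts G"
  define n where "n = card ?V"
  obtain vs where vs: "distinct vs" "set vs = ?V" using finite_verts finite_distinct_list by blast
  then have len: "length vs = n" by (metis distinct_card n_def)
  define L where "L = laplacian_mat G vs"
  have L: "L \<in> carrier_mat n n" by (simp add: L_def laplacian_mat_def len)
  have symA: "A x y \<longleftrightarrow> A y x" for x y unfolding A_def using arcs_symmetric by blast
  have LT: "L\<^sup>T = L"
    by (rule eq_matI) (use symA in \<open>auto simp: L_def laplacian_mat_def laplacian_def A_def\<close>)
  obtain ks where ks: "mset ks = M" using ex_mset by blast
  define es where "es = map real ks"
  have es: "mset es = image_mset real M" by (simp add: es_def ks)
  have len_es: "length ks = n" using size ks by (metis n_def size_mset)
  have cp: "char_poly L = (\<Prod>e\<leftarrow>es. [:- e, 1:])"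
  proof -
    have pr: "proots (char_poly L) = mset es"
      using spec laplacian_spectrum_eq[OF vs] by (simp add: L_def es)
    have "char_poly L = (\<Prod>e\<in>#proots (char_poly L). [:- e, 1:])"
      using degree_monic_char_poly[OF L] pr len_es by (intro monic_eq_prod_proots) (auto simp: es_def)
    then show ?thesis unfolding pr by (simp add: prod_mset_prod_list[symmetric])
  qed
  obtain u where u: "\<And>i. i < n \<Longrightarrow> u i \<in> carrier_vec n" "\<And>i. i < n \<Longrightarrow> L *\<^sub>v u i = es ! i \<cdot>\<^sub>v u i"
    "\<And>i. i < n \<Longrightarrow> u i \<bullet> u i = 1"
    "\<And>x y. x \<in> carrier_vec n \<Longrightarrow> y \<in> carrier_vec n \<Longrightarrow> x \<bullet> y = (\<Sum>i<n. (u i \<bullet> x) * (u i \<bullet> y))"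
    "\<And>i x. i < n \<Longrightarrow> x \<in> carrier_vec n \<Longrightarrow> u i \<bullet> (L *\<^sub>v x) = es ! i * (u i \<bullet> x)"
    using symmetric_mat_spectral[OF L LT cp] by blast
  define vc where "vc k = vec n (\<lambda>i. k (vs ! i))" for k :: "'a \<Rightarrow> real"
  have vc: "vc k \<in> carrier_vec n" for k by (simp add: vc_def)
  have bij: "bij_betw ((!) vs) {..<n} ?V" using bij_betw_nth[OF vs(1)] vs(2) len by simp
  have reindex: "(\<Sum>i<n. k (vs ! i)) = (\<Sum>x\<in>?V. k x)" for k :: "'a \<Rightarrow> real"
    by (rule sum.reindex_bij_betw[OF bij])
  have sp: "vc k \<bullet> vc k' = (\<Sum>x\<in>?V. k x * k' x)" for k k'
    using reindex[of "\<lambda>x. k x * k' x"] by (simp add: vc_def scalar_prod_def lessThan_atLeast0)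
  have Lvc: "L *\<^sub>v vc k = vc (\<lambda>x. \<Sum>y\<in>nbs ?V A x. k x - k y)" for k
  proof (rule eq_vecI)
    fix i assume "i < dim_vec (vc (\<lambda>x. \<Sum>y\<in>nbs ?V A x. k x - k y))"
    then have i: "i < n" by (simp add: vc_def)
    then have iV: "vs ! i \<in> ?V" using vs len nth_mem by metis
    have "(L *\<^sub>v vc k) $ i = (\<Sum>j<n. laplacian G (vs ! i) (vs ! j) * k (vs ! j))"
      using i L by (simp add: L_def laplacian_mat_def vc_def scalar_prod_def lessThan_atLeast0 len)
    also have "\<dots> = (\<Sum>y\<in>?V. laplacian G (vs ! i) y * k y)" by (rule reindex)
    finally show "(L *\<^sub>v vc k) $ i = vc (\<lambda>x. \<Sum>y\<in>nbs ?V A x. k x - k y) $ i"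
      using laplacian_mult[OF G iV, of k] i by (simp add: vc_def A_def)
  qed (use L in \<open>simp add: vc_def\<close>)
  have "count (mset ks) 0 = card {i. i < n \<and> 0 = ks ! i}"
    by (simp add: count_mset count_list_eq_length_filter length_filter_conv_card len_es)
  then obtain i0 where "{i. i < n \<and> 0 = ks ! i} = {i0}"
    using zero ks by (metis card_1_singletonE)
  then have i0: "i0 < n" "ks ! i0 = 0" "\<And>i. i < n \<Longrightarrow> i \<noteq> i0 \<Longrightarrow> ks ! i \<noteq> 0" by fastforce+
  have es_nth: "es ! i = real (ks ! i)" if "i < n" for i using that len_es by (simp add: es_def)
  let ?one = "vc (\<lambda>_. 1)"
  have "L *\<^sub>v ?one = 0\<^sub>v n" unfolding Lvc by (simp add: vc_def) (auto intro: eq_vecI)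
  \<comment> \<open>The constant function is killed by \<open>L\<close>, so its components at
    nonzero eigenvalues vanish and it is a multiple of \<open>u i0\<close>.\<close>
  then have one: "u i \<bullet> ?one = 0" if "i < n" "i \<noteq> i0" for i
    using u(5)[OF that(1) vc, of "\<lambda>_. 1"] u(1)[OF that(1)] es_nth[OF that(1)] i0(3)[OF that] by simp
  have proj: "x \<bullet> ?one = (u i0 \<bullet> x) * (u i0 \<bullet> ?one)" if "x \<in> carrier_vec n" for x
  proof -
    have "x \<bullet> ?one = (\<Sum>i<n. (u i \<bullet> x) * (u i \<bullet> ?one))" by (rule u(4)[OF that vc])
    also have "\<dots> = (\<Sum>i\<in>{i0}. (u i \<bullet> x) * (u i \<bullet> ?one))"
      using i0(1) one by (intro sum.mono_neutral_right) auto
    finally show ?thesis by simp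
  qed
  have "?one \<bullet> ?one = n" unfolding sp by (simp add: n_def)
  then have one0: "u i0 \<bullet> ?one \<noteq> 0" using proj[OF vc, of "\<lambda>_. 1"] i0(1) by auto
  have bounds: "(\<Sum>x\<in>?V. (h x)\<^sup>2) \<le> dirichlet ?V A h \<and> dirichlet ?V A h \<le> b * (\<Sum>x\<in>?V. (h x)\<^sup>2)"
    if h: "(\<Sum>x\<in>?V. h x) = 0" for h :: "'a \<Rightarrow> real"
  proof
    have "vc h \<bullet> ?one = 0" unfolding sp using h by simp
    then have h0: "u i0 \<bullet> vc h = 0" using proj[OF vc, of h] one0 by simp
    have sq: "(\<Sum>x\<in>?V. (h x)\<^sup>2) = (\<Sum>i<n. (u i \<bullet> vc h)\<^sup>2)"
      using sp[of h h] u(4)[OF vc vc, of h h] by (simp add: power2_eq_square)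
    have "dirichlet ?V A h = vc h \<bullet> (L *\<^sub>v vc h)"
      unfolding Lvc sp using dirichlet_eq[OF finite_verts symA, of h] by simp
    also have "\<dots> = (\<Sum>i<n. (u i \<bullet> vc h) * (u i \<bullet> (L *\<^sub>v vc h)))"
      using vc L by (intro u(4)) auto
    also have "\<dots> = (\<Sum>i<n. real (ks ! i) * (u i \<bullet> vc h)\<^sup>2)"
      using u(5)[OF _ vc] es_nth by (intro sum.cong) (auto simp: power2_eq_square)
    finally have di: "dirichlet ?V A h = (\<Sum>i<n. real (ks ! i) * (u i \<bullet> vc h)\<^sup>2)" .
    show "(\<Sum>x\<in>?V. (h x)\<^sup>2) \<le> dirichlet ?V A h"
      unfolding sq di
    proof (rule sum_mono)
      fix i assume "i \<in> {..<n}"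
      then show "(u i \<bullet> vc h)\<^sup>2 \<le> real (ks ! i) * (u i \<bullet> vc h)\<^sup>2"
        using i0(3)[of i] h0 mult_right_mono[of 1 "real (ks ! i)" "(u i \<bullet> vc h)\<^sup>2"] by (cases "i = i0") auto
    qed
    show "dirichlet ?V A h \<le> b * (\<Sum>x\<in>?V. (h x)\<^sup>2)"
      unfolding sq di sum_distrib_left
    proof (intro sum_mono mult_right_mono)
      fix i assume "i \<in> {..<n}"
      then have "ks ! i \<in># M" unfolding ks[symmetric] using len_es by simp
      then show "real (ks ! i) \<le> real b" using le by simp
    qed simp
  qed
  show "(\<Sum>x\<in>?V. h x) = 0 \<Longrightarrow> (\<Sum>x\<in>?V. (h x)\<^sup>2) \<le> dirichlet ?V A h"
    "(\<Sum>x\<in>?V. h x) = 0 \<Longrightarrow> dirichlet ?V A h \<le> b * (\<Sum>x\<in>?V. (h x)\<^sup>2)"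
    using bounds by blast+
  show "\<exists>f :: 'a \<Rightarrow> real. (\<forall>x\<in>?V. (\<Sum>y\<in>nbs ?V A x. f x - f y) = k * f x) \<and> (\<exists>x\<in>?V. f x \<noteq> 0)" if "k \<in># M"
  proof -
    have "k \<in> set ks" using that unfolding ks[symmetric] by simp
    then obtain i where i: "i < n" "ks ! i = k" unfolding in_set_conv_nth len_es by blast
    define f where "f x = u i $ (inv_into {..<n} ((!) vs) x)" for x
    have f_nth: "f (vs ! j) = u i $ j" if "j < n" for j
      using that bij by (simp add: f_def bij_betw_def inv_into_f_f)
    have fu: "vc f = u i" using u(1)[OF i(1)] f_nth by (intro eq_vecI) (auto simp: vc_def)
    have "(\<Sum>y\<in>nbs ?V A x. f x - f y) = k * f x" if x: "x \<in> ?V" for x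
    proof -
      obtain j where j: "j < n" "vs ! j = x" using x unfolding vs(2)[symmetric] in_set_conv_nth len by blast
      have "vc (\<lambda>x. \<Sum>y\<in>nbs ?V A x. f x - f y) $ j = (es ! i \<cdot>\<^sub>v vc f) $ j"
        using Lvc[of f] u(2)[OF i(1)] fu by simp
      then show ?thesis using j i es_nth[OF i(1)] by (simp add: vc_def)
    qed
    moreover have "\<exists>x\<in>?V. f x \<noteq> 0"
    proof (rule ccontr)
      assume "\<not> ?thesis"
      then have "vc f \<bullet> vc f = 0" unfolding sp by simp
      then show False using fu u(3)[OF i(1)] by simp
    qed
    ultimately show ?thesis by blast
  qed
qed

theorem mainTheorem4:
  fixes n i m :: nat
  assumes "32 \<le> n"
    and "2 \<le> i" and "i \<le> n - 2"
    and "2 \<le> m" and "m \<le> n - 2"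
    and "i \<noteq> m"
  shows "\<not> (\<exists>G :: 'a pair_pre_digraph. pair_graph G \<and> card (pverts G) = n \<and>
    laplacian_spectrum G = image_mset real (mset_set {0..n} + {#m#} - {#i, n#}))"
proof
  let ?M = "mset_set {0..n} + {#m#} - {#i, n#}"
  assume "\<exists>G :: 'a pair_pre_digraph. pair_graph G \<and> card (pverts G) = n \<and>
    laplacian_spectrum G = image_mset real ?M"
  then obtain G :: "'a pair_pre_digraph" where G: "pair_graph G" and n: "card (pverts G) = n"
    and spec: "laplacian_spectrum G = image_mset real ?M" by blast
  interpret pair_graph G by (rule G)
  have cnt: "count ?M k = (if k \<le> n then 1 else 0) + (if k = m then 1 else 0)
      - (if k = i then 1 else 0) - (if k = n then 1 else 0)" for k
    by (simp add: count_mset_set')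
  have mem: "k \<in># ?M \<longleftrightarrow> count ?M k \<noteq> 0" for k by (metis count_eq_zero_iff)
  \<comment> \<open>Multiset difference truncates; the size drops by exactly two only because
    \<open>i\<close> and \<open>n\<close> are both present and distinct.\<close>
  have "{#i, n#} \<subseteq># mset_set {0..n} + {#m#}"
    using assms by (intro mset_subset_eqI) (auto simp: count_mset_set')
  then have M1: "size ?M = card (pverts G)" by (simp add: size_Diff_submset n)
  have M2: "count ?M 0 = 1" unfolding cnt using assms by simp
  have M3: "\<forall>k\<in>#?M. k \<le> n - 1"
  proof
    fix k assume "k \<in># ?M"
    then have "count ?M k \<noteq> 0" unfolding mem .
    then show "k \<le> n - 1" unfolding cnt using assms by (simp split: if_splits)
  qed
  note gap = laplacian_spectrum_gap[OF G spec M1 M2 M3]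
  \<comment> \<open>Both survive the removal since \<open>i\<close> is neither 1 nor
    \<open>n - 1\<close>.\<close>
  have "1 \<in># ?M" "n - 1 \<in># ?M" unfolding mem cnt using assms by auto
  then obtain f g x y where
    f: "\<forall>x\<in>pverts G. (\<Sum>y\<in>nbs (pverts G) (\<lambda>x y. (x, y) \<in> parcs G) x. f x - f y) = real 1 * f x"
      "x \<in> pverts G" "f x \<noteq> 0"
    and g: "\<forall>x\<in>pverts G. (\<Sum>y\<in>nbs (pverts G) (\<lambda>x y. (x, y) \<in> parcs G) x. g x - g y) = real (n - 1) * g x"
      "y \<in> pverts G" "g y \<noteq> 0"
    using gap(3)[of 1] gap(3)[of "n - 1"] by blast
  have r: "real (n - 1) = real (card (pverts G)) - 1" using assms n by simp
  show False
  proof (rule no_gap_eigenfunctions[OF finite_verts])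
    show "(x, y) \<in> parcs G \<longleftrightarrow> (y, x) \<in> parcs G" for x y using arcs_symmetric by blast
    show "32 \<le> card (pverts G)" using assms n by simp
    show "(\<Sum>x\<in>pverts G. (h x)\<^sup>2) \<le> dirichlet (pverts G) (\<lambda>x y. (x, y) \<in> parcs G) h"
      "dirichlet (pverts G) (\<lambda>x y. (x, y) \<in> parcs G) h \<le> (real (card (pverts G)) - 1) * (\<Sum>x\<in>pverts G. (h x)\<^sup>2)"
      if "(\<Sum>x\<in>pverts G. h x) = 0" for h
      using gap(1,2)[OF that] unfolding r by auto
    show "(\<Sum>y\<in>nbs (pverts G) (\<lambda>x y. (x, y) \<in> parcs G) x. f x - f y) = f x" if "x \<in> pverts G" for x
      using f(1) that by simp
    show "(\<Sum>y\<in>nbs (pverts G) (\<lambda>x y. (x, y) \<in> parcs G) x. g x - g y) = (real (card (pverts G)) - 1) * g x"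
      if "x \<in> pverts G" for x
      using g(1) that r by simp
  qed (use f g in auto)
qed

end
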